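(* Let $n\geq 4$ be an integer, let $G=\mathrm{Sym}(n)$ be the symmetric group on $n$ letters, and let $Z_n$ be the set of all $n$-cycles in $G$. Let $\Gamma_n=\mathrm{Cay}(G,Z_n)$. Then $\Gamma_n$ is an integral hyperenergetic graph, its energy is $\mathcal{E}(\Gamma_n)=2^{n-1}(n-1)!$, and its nullity is $\eta(\Gamma_n)=n!-\binom{2n-2}{n-1}$.
   Context: For a finite group $G$ and an inverse-closed subset $S\subseteq G$ with $1\notin S$, the Cayley graph $\mathrm{Cay}(G,S)$ has vertex set $G$, with $u,v$ adjacent iff $v=au$ for some $a\in S$. The eigenvalues of a simple graph are the eigenvalues of its adjacency matrix. A graph is integral if all its eigenvalues are integers. The energy $\mathcal{E}(\Gamma)$ of a graph $\Gamma$ is the sum of the absolute values of its eigenvalues (with multiplicity). A simple graph $\Gamma$ on $N$ vertices is hyperenergetic if $\mathcal{E}(\Gamma)>2N-2$. The nullity $\eta(\Gamma)$ is the multiplicity of $0$ as an eigenvalue of $\Gamma$. *)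

theory Defs
  imports Complex_Main "HOL-Computational_Algebra.Computational_Algebra"
    "HOL-Combinatorics.Combinatorics"
begin

text \<open>A simple graph is given by a finite vertex set V and an adjacency relation E.
  Its characteristic polynomial det(x I - A), with A the adjacency matrix, is written
  out via the Leibniz formula over permutations of V (basis-free, no ordering needed).\<close>
definition graph_charpoly :: "'a set \<Rightarrow> ('a \<Rightarrow> 'a \<Rightarrow> bool) \<Rightarrow> complex poly" where
  "graph_charpoly V E =
     (\<Sum>p | p permutes V. of_int (sign p) *
        (\<Prod>v\<in>V. (if p v = v then [:0, 1:] else 0) - (if E v (p v) then 1 else 0)))"

definition graph_eigenvalues :: "'a set \<Rightarrow> ('a \<Rightarrow> 'a \<Rightarrow> bool) \<Rightarrow> complex multiset" where
  "graph_eigenvalues V E = proots (graph_charpoly V E)"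

definition graph_integral :: "'a set \<Rightarrow> ('a \<Rightarrow> 'a \<Rightarrow> bool) \<Rightarrow> bool" where
  "graph_integral V E \<longleftrightarrow> (\<forall>e\<in>#graph_eigenvalues V E. e \<in> \<int>)"

definition graph_energy :: "'a set \<Rightarrow> ('a \<Rightarrow> 'a \<Rightarrow> bool) \<Rightarrow> real" where
  "graph_energy V E = (\<Sum>e\<in>#graph_eigenvalues V E. cmod e)"

definition hyperenergetic :: "'a set \<Rightarrow> ('a \<Rightarrow> 'a \<Rightarrow> bool) \<Rightarrow> bool" where
  "hyperenergetic V E \<longleftrightarrow> graph_energy V E > 2 * real (card V) - 2"

definition graph_nullity :: "'a set \<Rightarrow> ('a \<Rightarrow> 'a \<Rightarrow> bool) \<Rightarrow> nat" where
  "graph_nullity V E = count (graph_eigenvalues V E) 0"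

definition cayley_adj :: "('b \<Rightarrow> 'b) set \<Rightarrow> ('b \<Rightarrow> 'b) \<Rightarrow> ('b \<Rightarrow> 'b) \<Rightarrow> bool" where
  "cayley_adj S u v \<longleftrightarrow> (\<exists>a\<in>S. v = a \<circ> u)"

definition Sym :: "nat \<Rightarrow> (nat \<Rightarrow> nat) set" where
  "Sym n = {p. p permutes {1..n}}"

definition full_cycles :: "nat \<Rightarrow> (nat \<Rightarrow> nat) set" where
  "full_cycles n = {p. \<exists>cs. distinct cs \<and> set cs = {1..n} \<and> p = cycle_of_list cs}"

end

theory Submission
  imports Defs "Jordan_Normal_Form.Schur_Decomposition"
begin

text \<open>
  Let \<open>\<chi>\<^sub>k\<close> be the character of the \<open>k\<close>-th exterior power of the standard representation of
  \<open>Sym X\<close>, \<open>n = card X\<close>; it has degree \<open>n - 1 choose k\<close> (hook shape \<open>(n - k, 1\<^sup>k)\<close>). Two facts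
  suffice. First, the alternating sum of the \<open>\<chi>\<^sub>k\<close> is \<open>n\<close> times the indicator of the \<open>n\<close>-cycles.
  Second, summing \<open>\<chi>\<^sub>k\<close> over the left translates by all \<open>n\<close>-cycles multiplies it by
  \<open>\<lambda>\<^sub>k = (-1)\<^sup>k k! (n - 1 - k)!\<close>. Together they express the number of walks of length \<open>m\<close> in the
  Cayley graph through the \<open>\<chi>\<^sub>k\<close>, and the number of closed walks is the sum over \<open>k\<close> of
  \<open>(n - 1 choose k)\<^sup>2 \<lambda>\<^sub>k\<^sup>m\<close> for \<open>m > 0\<close>, which determines the nonzero spectrum. Both facts are
  proved by direct sign counting, so neither irreducibility nor Schur orthogonality is needed.
\<close>

unbundle no m_inv_syntax

section \<open>Permutations and invariant sets\<close>

lemma image_eq_imp_bij_betw: "finite I \<Longrightarrow> p ` I = I \<Longrightarrow> bij_betw p I I"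
  by (simp add: bij_betw_def eq_card_imp_inj_on)

lemma permutes_image_Diff:
  assumes "p permutes X" "p ` I = I"
  shows "p ` (X - I) = X - I"
  using assms by (simp add: image_set_diff permutes_inj permutes_image)

lemma comp_disjoint_permutes:
  assumes q: "q permutes I" and r: "r permutes (X - I)" and "I \<subseteq> X"
  shows "q \<circ> r permutes X" "(q \<circ> r) ` I = I"
    and "restrict_id (q \<circ> r) I = q" "restrict_id (q \<circ> r) (X - I) = r"
proof -
  have on_I: "(q \<circ> r) v = q v" if "v \<in> I" for v
    using that permutes_not_in[OF r, of v] by simp
  have off_I: "(q \<circ> r) v = r v" if "v \<notin> I" for v
  proof -
    have "r v \<notin> I" using that permutes_in_image[OF r, of v] permutes_not_in[OF r, of v] by auto
    then show ?thesis using permutes_not_in[OF q] by simp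
  qed
  show "q \<circ> r permutes X"
    using assms by (meson Diff_subset permutes_compose permutes_subset)
  have "(q \<circ> r) ` I = q ` I" using on_I by (intro image_cong) auto
  then show "(q \<circ> r) ` I = I" using q by (simp add: permutes_image)
  show "restrict_id (q \<circ> r) I = q"
    using on_I permutes_not_in[OF q] by (auto simp: fun_eq_iff restrict_id_def)
  show "restrict_id (q \<circ> r) (X - I) = r"
    using off_I permutes_not_in[OF r] by (auto simp: fun_eq_iff restrict_id_def)
qed

lemma bij_betw_restrict_id_pair:
  assumes "I \<subseteq> X"
  shows "bij_betw (\<lambda>p. (restrict_id p I, restrict_id p (X - I)))
    {p. p permutes X \<and> p ` I = I} ({q. q permutes I} \<times> {r. r permutes (X - I)})"
proof (rule bij_betw_byWitness[where f' = "\<lambda>(q, r). q \<circ> r"])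
  have "(restrict_id p I \<circ> restrict_id p (X - I)) v = p v" if "p permutes X" "p ` I = I" for p v
    using permutes_image_Diff[OF that] permutes_not_in[OF that(1), of v] assms
    by (cases "v \<in> I"; cases "v \<in> X") (auto simp: restrict_id_def)
  then show "\<forall>p\<in>{p. p permutes X \<and> p ` I = I}.
      (case (restrict_id p I, restrict_id p (X - I)) of (q, r) \<Rightarrow> q \<circ> r) = p"
    by (simp add: fun_eq_iff)
  have "restrict_id p S permutes S" if "inj p" "p ` S = S" for p :: "'a \<Rightarrow> 'a" and S
    using that by (intro permutes_restrict_id) (auto simp: bij_betw_def intro: inj_on_subset)
  then show "(\<lambda>p. (restrict_id p I, restrict_id p (X - I))) ` {p. p permutes X \<and> p ` I = I}
      \<subseteq> {q. q permutes I} \<times> {r. r permutes (X - I)}"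
    by (auto simp: permutes_inj permutes_image_Diff)
qed (use comp_disjoint_permutes[OF _ _ assms] in \<open>simp_all add: image_subset_iff del: o_apply\<close>)

lemma transpose_image_exchange:
  assumes "x \<in> I" "y \<notin> I"
  shows "transpose x y ` I = insert y (I - {x})"
  using assms by (auto simp: in_transpose_image_iff transpose_def)

lemma transpose_comp_image_eq_iff:
  "(transpose x y \<circ> p) ` I = I \<longleftrightarrow> p ` I = transpose x y ` I"
proof -
  have "transpose x y ` A = I \<longleftrightarrow> A = transpose x y ` I" for A
    by (auto simp: image_comp)
  from this[of "p ` I"] show ?thesis by (simp add: image_comp)
qed

lemma invariant_comp_transpose_mem:
  assumes p: "inj p" "p ` I = I" and "finite I" and x: "x \<in> I" and y: "y \<notin> I"
    and T: "(p \<circ> transpose x y) ` T = T" "y \<in> T"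
  shows "x \<in> T"
proof (rule ccontr)
  assume "x \<notin> T"
  then have "transpose x y ` T = insert x (T - {y})"
    using transpose_image_exchange[of y T x] T(2) by (simp add: transpose_commute)
  then have "p ` insert x (T - {y}) = T" using T(1) by (metis image_comp)
  then have "p ` (insert x (T - {y}) \<inter> I) = T \<inter> I"
    using p image_Int by metis
  moreover have "insert x (T - {y}) \<inter> I = insert x (T \<inter> I)" using x y by auto
  ultimately have "card (insert x (T \<inter> I)) = card (T \<inter> I)"
    using p(1) by (metis card_image inj_on_subset subset_UNIV)
  then show False using \<open>x \<notin> T\<close> \<open>finite I\<close> by simp
qed

lemma image_orbit:
  assumes "permutation p"
  shows "p ` orbit p x = orbit p x"
proof
  show "p ` orbit p x \<subseteq> orbit p x" by (auto intro: orbit.step)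
  show "orbit p x \<subseteq> p ` orbit p x"
    using permutation_self_in_orbit[OF assms] by (auto elim: orbit.cases)
qed

lemma orbit_subset_invariant:
  assumes "x \<in> T" "p ` T \<subseteq> T"
  shows "orbit p x \<subseteq> T"
proof
  show "y \<in> T" if "y \<in> orbit p x" for y
    using that assms by induction auto
qed

section \<open>Cyclic permutations\<close>

lemma cyclic_on_invariant_subset:
  assumes "cyclic_on p S" "T \<subseteq> S" "p ` T = T"
  shows "T = {} \<or> T = S"
proof (rule disjCI)
  assume "T \<noteq> S"
  show "T = {}"
  proof (rule ccontr)
    assume "T \<noteq> {}"
    then obtain t where "t \<in> T" by blast
    then have "S \<subseteq> T"
      using orbit_cyclic_eq3[OF assms(1), of t] orbit_subset_invariant[of t T p] assms by blast
    then show False using assms(2) \<open>T \<noteq> S\<close> by blast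
  qed
qed

lemma cyclic_on_image_eq:
  assumes "permutation p" "cyclic_on p S"
  shows "p ` S = S"
  using assms(2) image_orbit[OF assms(1)] unfolding cyclic_on_def by metis

lemma cyclic_onI_minimal_invariant:
  assumes "permutation p" "S \<noteq> {}" "p ` S = S"
    and minimal: "\<And>T. T \<subseteq> S \<Longrightarrow> p ` T = T \<Longrightarrow> T = {} \<or> T = S"
  shows "cyclic_on p S"
proof -
  obtain s where "s \<in> S" using assms(2) by blast
  then have "orbit p s \<subseteq> S" using assms(3) by (intro orbit_subset_invariant) auto
  then have "orbit p s = S" using minimal image_orbit[OF assms(1)] orbit_nonempty by metis
  with \<open>s \<in> S\<close> show ?thesis by (simp add: cyclic_on_singleI)
qed

lemma cyclic_on_restrict_id: "cyclic_on (restrict_id p S) S \<longleftrightarrow> cyclic_on p S"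
  by (rule cyclic_cong) simp

context
  fixes q :: "'a \<Rightarrow> 'a" and X I :: "'a set" and x y :: 'a
  assumes q: "q permutes X" "q ` I = I" and fin: "finite X" and I: "I \<subseteq> X"
    and x: "x \<in> I" and y: "y \<in> X - I"
begin

lemma cyclic_on_join_comp_transpose:
  assumes cyclic: "cyclic_on q I" "cyclic_on q (X - I)"
  shows "cyclic_on (q \<circ> transpose x y) X"
proof (rule cyclic_onI_minimal_invariant)
  let ?p = "q \<circ> transpose x y"
  have "?p permutes X"
    using q x y I by (intro permutes_compose permutes_swap_id) auto
  then show "permutation ?p" "?p ` X = X"
    using fin permutes_imp_permutation permutes_image by blast+
  show "X \<noteq> {}" using x I by blast
  fix T assume T: "T \<subseteq> X" "?p ` T = T"
  have inj: "inj q" using q(1) by (rule permutes_inj)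
  have inv_compl: "q ` (X - I) = X - I" using q by (rule permutes_image_Diff)
  have xy: "x \<in> T \<longleftrightarrow> y \<in> T"
  proof
    show "x \<in> T" if "y \<in> T"
      using invariant_comp_transpose_mem[OF inj q(2) _ x _ T(2) that] fin I y
      by (auto intro: finite_subset)
    show "y \<in> T" if "x \<in> T"
      using invariant_comp_transpose_mem[OF inj inv_compl _ y _ _ that] fin x T(2)
      by (auto simp: transpose_commute)
  qed
  then have "q ` T = T" using T(2) by (metis image_comp transpose_image_eq)
  then have "q ` (T \<inter> I) = T \<inter> I" "q ` (T - I) = T - I"
    using inj q(2) by (simp_all add: image_Int image_set_diff)
  then have "T \<inter> I = {} \<or> T \<inter> I = I" "T - I = {} \<or> T - I = X - I"
    using cyclic_on_invariant_subset[OF cyclic(1), of "T \<inter> I"]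
      cyclic_on_invariant_subset[OF cyclic(2), of "T - I"] T(1) by blast+
  then show "T = {} \<or> T = X" using xy x y T(1) I by blast
qed

lemma cyclic_on_split_comp_transpose:
  assumes cyclic: "cyclic_on (q \<circ> transpose x y) X"
  shows "cyclic_on q I"
proof (rule cyclic_onI_minimal_invariant)
  show "permutation q" using q(1) fin permutes_imp_permutation by blast
  show "q ` I = I" by (rule q(2))
  show "I \<noteq> {}" using x by blast
  have avoid_x: "T = {}" if T: "T \<subseteq> I" "q ` T = T" "x \<notin> T" for T
  proof -
    have "transpose x y ` T = T" using T y by (intro transpose_image_eq) blast
    then have "(q \<circ> transpose x y) ` T = T" using T(2) by (metis image_comp)
    then show ?thesis
      using cyclic_on_invariant_subset[OF cyclic, of T] T I x by blast
  qed
  fix T assume T: "T \<subseteq> I" "q ` T = T"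
  show "T = {} \<or> T = I"
  proof (cases "x \<in> T")
    case True
    have "q ` (I - T) = I - T"
      using q T by (simp add: image_set_diff permutes_inj)
    then have "I - T = {}" using True by (intro avoid_x) auto
    then show ?thesis using T(1) by blast
  qed (use avoid_x T in blast)
qed

end

lemma cyclic_on_comp_transpose_iff:
  assumes q: "q permutes X" "q ` I = I" and fin: "finite X" and I: "I \<subseteq> X"
    and x: "x \<in> I" and y: "y \<in> X - I"
  shows "cyclic_on (q \<circ> transpose x y) X \<longleftrightarrow> cyclic_on q I \<and> cyclic_on q (X - I)"
proof
  assume cyclic: "cyclic_on (q \<circ> transpose x y) X"
  then have "cyclic_on (q \<circ> transpose y x) X" by (simp add: transpose_commute)
  then have "cyclic_on q (X - I)"
    using cyclic_on_split_comp_transpose[OF q(1) permutes_image_Diff[OF q] fin _ y, of x] x I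
    by auto
  with cyclic_on_split_comp_transpose[OF q fin I x y cyclic]
  show "cyclic_on q I \<and> cyclic_on q (X - I)" by blast
qed (use cyclic_on_join_comp_transpose[OF assms] in blast)

definition cyclic_perms :: "'a set \<Rightarrow> ('a \<Rightarrow> 'a) set" where
  "cyclic_perms S = {p. p permutes S \<and> cyclic_on p S}"

lemma cyclic_perms_permutes: "p \<in> cyclic_perms S \<Longrightarrow> p permutes S"
  by (simp add: cyclic_perms_def)

lemma cyclic_perms_cyclic_on: "p \<in> cyclic_perms S \<Longrightarrow> cyclic_on p S"
  by (simp add: cyclic_perms_def)

lemma finite_cyclic_perms: "finite S \<Longrightarrow> finite (cyclic_perms S)"
  by (rule finite_subset[OF _ finite_permutations]) (auto simp: cyclic_perms_def)

lemma cyclic_perms_singleton [simp]: "cyclic_perms {x} = {id}"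
  by (auto simp: cyclic_perms_def cyclic_on_def orbit_eq_singleton_iff[THEN iffD2])

lemma card_cyclic_perms_split:
  assumes fin: "finite X" and I: "I \<subseteq> X" and x: "x \<in> I" and y: "y \<in> X - I"
  shows "card {a \<in> cyclic_perms X. (a \<circ> transpose x y) ` I = I} =
    card (cyclic_perms I) * card (cyclic_perms (X - I))"
proof -
  let ?t = "transpose x y"
  let ?split = "\<lambda>p. (restrict_id p I, restrict_id p (X - I))"
  let ?Inv = "{p. p permutes X \<and> p ` I = I}"
  have t: "?t permutes X" using x y I by (intro permutes_swap_id) auto
  have "bij_betw (\<lambda>a. a \<circ> ?t) {a. a permutes X \<and> (a \<circ> ?t) ` I = I} ?Inv"
    by (rule bij_betw_byWitness[where f' = "\<lambda>q. q \<circ> ?t"])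
      (auto simp: comp_assoc permutes_compose[OF t])
  then have "bij_betw (?split \<circ> (\<lambda>a. a \<circ> ?t)) {a. a permutes X \<and> (a \<circ> ?t) ` I = I}
      ({q. q permutes I} \<times> {r. r permutes (X - I)})"
    using bij_betw_restrict_id_pair[OF I] by (rule bij_betw_trans)
  then have bij: "bij_betw (?split \<circ> (\<lambda>a. a \<circ> ?t))
      {a \<in> {a. a permutes X \<and> (a \<circ> ?t) ` I = I}. cyclic_on a X}
      {qr \<in> {q. q permutes I} \<times> {r. r permutes (X - I)}.
        cyclic_on (fst qr) I \<and> cyclic_on (snd qr) (X - I)}"
  proof (rule bij_betw_Collect)
    fix a assume "a \<in> {a. a permutes X \<and> (a \<circ> ?t) ` I = I}"
    then have "a \<circ> ?t permutes X" "(a \<circ> ?t) ` I = I" by (auto intro: permutes_compose[OF t])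
    from cyclic_on_comp_transpose_iff[OF this fin I x y]
    show "cyclic_on (fst ((?split \<circ> (\<lambda>a. a \<circ> ?t)) a)) I
        \<and> cyclic_on (snd ((?split \<circ> (\<lambda>a. a \<circ> ?t)) a)) (X - I) \<longleftrightarrow> cyclic_on a X"
      by (simp only: comp_assoc transpose_comp_involutory comp_id o_apply[of ?split]
          fst_conv snd_conv cyclic_on_restrict_id)
  qed
  have target: "{qr \<in> {q. q permutes I} \<times> {r. r permutes (X - I)}.
      cyclic_on (fst qr) I \<and> cyclic_on (snd qr) (X - I)} = cyclic_perms I \<times> cyclic_perms (X - I)"
    by (auto simp: cyclic_perms_def)
  have source: "{a \<in> {a. a permutes X \<and> (a \<circ> ?t) ` I = I}. cyclic_on a X} =
      {a \<in> cyclic_perms X. (a \<circ> ?t) ` I = I}"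
    by (auto simp: cyclic_perms_def)
  show ?thesis
    using bij_betw_same_card[OF bij] unfolding source target by (simp only: card_cartesian_product)
qed

lemma inv_mem_cyclic_perms_insert:
  assumes a: "a \<in> cyclic_perms (insert x S)" and S: "S \<noteq> {}" "x \<notin> S"
  shows "inv a x \<in> S"
proof -
  note perm = cyclic_perms_permutes[OF a]
  have "a x \<noteq> x"
  proof
    assume "a x = x"
    then have "{x} = insert x S"
      using cyclic_on_invariant_subset[OF cyclic_perms_cyclic_on[OF a], of "{x}"] by simp
    then show False using S by auto
  qed
  then have "inv a x \<noteq> x" using permutes_inverses(1)[OF perm, of x] by metis
  moreover have "inv a x \<in> insert x S"
    using permutes_in_image[OF permutes_inv[OF perm], of x] by simp
  ultimately show ?thesis by simp
qed

lemma card_cyclic_perms: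
  assumes "finite S" "S \<noteq> {}"
  shows "card (cyclic_perms S) = fact (card S - 1)"
  using assms
proof (induction S rule: finite_ne_induct)
  case (insert x S)
  let ?C = "cyclic_perms (insert x S)"
  have "inv a x = y \<longleftrightarrow> (a \<circ> transpose x y) ` {x} = {x}" if "a \<in> ?C" for a y
    using permutes_inv_eq[OF cyclic_perms_permutes[OF that], of x y] by auto
  then have fibre: "card {a \<in> ?C. inv a x = y} = fact (card S - 1)" if "y \<in> S" for y
    using card_cyclic_perms_split[of "insert x S" "{x}" x y] insert that
    by (simp add: insert_Diff_if cong: conj_cong)
  have "card ?C = (\<Sum>y\<in>S. card {a \<in> ?C. inv a x = y})"
    using sum.group[of ?C S "\<lambda>a. inv a x" "\<lambda>_. 1 :: nat"] insert.hyps
    by (simp add: finite_cyclic_perms inv_mem_cyclic_perms_insert image_subset_iff)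
  also have "\<dots> = card S * fact (card S - 1)" by (simp add: fibre)
  also have "\<dots> = fact (card (insert x S) - 1)"
    using insert.hyps by (simp add: fact_reduce[of "card S"] card_gt_0_iff)
  finally show ?case .
qed simp

lemma sign_cyclic_perm:
  assumes "finite S" "p \<in> cyclic_perms S"
  shows "sign p = (-1) ^ (card S - 1)"
proof -
  have "S \<noteq> {}" using assms(2) by (auto simp: cyclic_perms_def cyclic_on_def)
  with assms(1) show ?thesis using assms(2)
  proof (induction S arbitrary: p rule: finite_ne_induct)
    case (insert x S)
    let ?q = "p \<circ> transpose x (inv p x)"
    note p = cyclic_perms_permutes[OF insert.prems]
    have y: "inv p x \<in> S" using inv_mem_cyclic_perms_insert[OF insert.prems] insert.hyps by blast
    have fixes_x: "?q x = x" using permutes_inverses(1)[OF p] by simp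
    have q: "?q permutes insert x S"
      using p y by (intro permutes_compose permutes_swap_id) auto
    have "cyclic_on (?q \<circ> transpose x (inv p x)) (insert x S)"
      using insert.prems by (simp add: comp_assoc cyclic_perms_cyclic_on)
    then have "cyclic_on ?q (insert x S - {x})"
      using cyclic_on_comp_transpose_iff[OF q, of "{x}" x "inv p x"] fixes_x y insert.hyps by auto
    moreover have "?q permutes S"
      using fixes_x by (intro permutes_superset[OF q]) auto
    ultimately have "sign ?q = (-1) ^ (card S - 1)"
      using insert.IH insert.hyps by (simp add: cyclic_perms_def)
    moreover have "sign ?q = - sign p"
      using p y insert.hyps permutes_imp_permutation[of "insert x S" p]
      by (auto simp: sign_compose sign_swap_id permutation_swap_id)
    moreover have "(-1) ^ card S = - ((-1) ^ (card S - 1) :: int)"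
      using insert.hyps by (cases "card S") auto
    ultimately show ?case using insert.hyps by simp
  qed simp
qed

lemma sign_on_cyclic:
  assumes "permutation p" "cyclic_on p S"
  shows "sign_on S p = (-1) ^ (card S - 1)"
proof -
  have fin: "finite S" using assms(2) by (rule finite_cyclic_on)
  have "bij_betw p S S"
    using assms fin by (intro image_eq_imp_bij_betw cyclic_on_image_eq)
  then have "restrict_id p S \<in> cyclic_perms S"
    using assms(2) by (simp add: cyclic_perms_def permutes_restrict_id cyclic_on_restrict_id)
  then show ?thesis unfolding sign_on_def by (rule sign_cyclic_perm[OF fin])
qed

lemma inv_cyclic_perms:
  assumes "finite X" "a \<in> cyclic_perms X"
  shows "inv a \<in> cyclic_perms X"
proof -
  have "permutation a" using assms cyclic_perms_permutes permutes_imp_permutation by blast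
  then show ?thesis
    using assms(2) by (simp add: cyclic_perms_def permutes_inv cyclic_on_def orbit_inv_eq)
qed

lemma conj_cyclic_perms:
  assumes a: "a \<in> cyclic_perms X" and t: "t permutes X"
  shows "t \<circ> a \<circ> inv t \<in> cyclic_perms X"
proof -
  have "cyclic_on (t \<circ> a \<circ> inv t) (t ` X)"
    using a permutes_inverses(2)[OF t]
    by (intro cyclic_on_image[of a]) (auto simp: cyclic_perms_def)
  then show ?thesis
    using a t by (simp add: cyclic_perms_def permutes_image permutes_compose permutes_inv)
qed

lemma cyclic_on_cycle_of_list:
  assumes "distinct cs" "cs \<noteq> []"
  shows "cyclic_on (cycle_of_list cs) (set cs)"
proof -
  let ?p = "cycle_of_list cs"
  have "cs ! k \<in> orbit ?p (cs ! 0)" if "k < length cs" for k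
  proof -
    have "(?p ^^ k) (cs ! 0) = rotate k cs ! 0"
      using cyclic_rotation[OF assms(1), of k] assms(2) by (metis length_greater_0_conv nth_map)
    also have "\<dots> = cs ! k" using that by (simp add: nth_rotate assms(2))
    finally have "cs ! k = (?p ^^ k) (cs ! 0)" ..
    then show ?thesis
      unfolding orbit_altdef_permutation[OF permutation_of_cycle] by blast
  qed
  then have "set cs \<subseteq> orbit ?p (cs ! 0)" by (auto simp: in_set_conv_nth)
  moreover have "orbit ?p (cs ! 0) \<subseteq> set cs"
    using cycle_permutes assms(2) by (intro permutes_orbit_subset) auto
  ultimately have "set cs = orbit ?p (cs ! 0)" by (rule subset_antisym)
  moreover have "cs ! 0 \<in> set cs" using assms(2) by simp
  ultimately show ?thesis by (intro cyclic_on_singleI)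
qed

lemma cyclic_perm_eq_cycle_of_list:
  assumes "finite S" "p \<in> cyclic_perms S"
  obtains cs where "distinct cs" "set cs = S" "p = cycle_of_list cs"
proof -
  have p: "p permutes S" using assms(2) by (rule cyclic_perms_permutes)
  then have perm: "permutation p" using assms(1) permutes_imp_permutation by blast
  obtain s where "S = orbit p s" using assms(2) by (auto simp: cyclic_perms_def cyclic_on_def)
  then have set: "set (support p s) = S"
    unfolding support_set[OF perm] orbit_altdef_permutation[OF perm] by auto
  have "p v = cycle_of_list (support p s) v" for v
  proof (cases "v \<in> S")
    case True
    then show ?thesis using cycle_restrict[OF perm] set by blast
  next
    case False
    then have "cycle_of_list (support p s) v = v" using set by (intro id_outside_supp) simp
    then show ?thesis using permutes_not_in[OF p False] by simp
  qed
  then show ?thesis using that cycle_of_permutation[OF perm] set by blast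
qed

lemma full_cycles_eq_cyclic_perms:
  assumes "0 < n"
  shows "full_cycles n = cyclic_perms {1..n}"
proof (intro equalityI subsetI)
  fix p assume "p \<in> full_cycles n"
  then obtain cs where cs: "distinct cs" "set cs = {1..n}" "p = cycle_of_list cs"
    by (auto simp: full_cycles_def)
  moreover have "cs \<noteq> []" using cs(2) assms by auto
  ultimately show "p \<in> cyclic_perms {1..n}"
    using cyclic_on_cycle_of_list[of cs] cycle_permutes[of cs] by (simp add: cyclic_perms_def)
next
  fix p assume "p \<in> cyclic_perms {1..n}"
  then obtain cs where "distinct cs" "set cs = {1..n}" "p = cycle_of_list cs"
    using cyclic_perm_eq_cycle_of_list finite_atLeastAtMost by blast
  then show "p \<in> full_cycles n" by (auto simp: full_cycles_def)
qed

section \<open>Principal minors of permutation matrices\<close>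

definition perm_minor :: "('a \<Rightarrow> 'a) \<Rightarrow> 'a set \<Rightarrow> int" where
  "perm_minor p I = (if p ` I = I then sign_on I p else 0)"

lemma perm_minor_eq_0: "v \<in> I \<Longrightarrow> p v \<notin> I \<Longrightarrow> perm_minor p I = 0"
  unfolding perm_minor_def by (metis imageI)

lemma perm_minor_cong:
  assumes "\<And>v. v \<in> I \<Longrightarrow> p v \<in> I \<or> q v \<in> I \<Longrightarrow> p v = q v"
  shows "perm_minor p I = perm_minor q I"
proof (cases "p ` I \<subseteq> I")
  case True
  then have "p v = q v" if "v \<in> I" for v using assms that by blast
  then have "p ` I = q ` I" "sign_on I p = sign_on I q" by auto
  then show ?thesis by (simp only: perm_minor_def)
next
  case False
  then obtain v where "v \<in> I" "p v \<notin> I" by blast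
  moreover from this have "q v \<notin> I" using assms by metis
  ultimately show ?thesis by (simp add: perm_minor_eq_0)
qed

lemma perm_minor_empty [simp]: "perm_minor p {} = 1"
proof -
  have "restrict_id p {} = id" by (simp add: fun_eq_iff)
  then show ?thesis by (simp add: perm_minor_def sign_on_def)
qed

lemma perm_minor_id [simp]: "perm_minor id I = 1"
  by (simp add: perm_minor_def)

lemma perm_minor_comp_right:
  assumes "finite I" "q ` I = I"
  shows "perm_minor (p \<circ> q) I = perm_minor p I * perm_minor q I"
proof -
  have "(p \<circ> q) ` I = p ` I" using assms(2) by (metis image_comp)
  then show ?thesis
    using assms by (simp add: perm_minor_def sign_on_compose image_eq_imp_bij_betw del: o_apply)
qed

lemma perm_minor_comp_left:
  assumes "finite I" "inj p" "p ` I = I"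
  shows "perm_minor (p \<circ> q) I = perm_minor p I * perm_minor q I"
proof -
  have "(p \<circ> q) ` I = I \<longleftrightarrow> q ` I = I"
    using assms by (metis image_comp inj_image_eq_iff)
  then show ?thesis
    using assms by (simp add: perm_minor_def sign_on_compose image_eq_imp_bij_betw del: o_apply)
qed

lemma perm_minor_transpose_inside:
  assumes "x \<in> I" "y \<in> I" "x \<noteq> y"
  shows "perm_minor (transpose x y) I = -1"
  using assms by (simp add: perm_minor_def sign_on_transpose)

lemma perm_minor_transpose_outside:
  assumes "x \<notin> I" "y \<notin> I"
  shows "perm_minor (transpose x y) I = 1"
proof -
  have "perm_minor (transpose x y) I = perm_minor id I"
    using assms by (intro perm_minor_cong) (auto simp: transpose_def)
  then show ?thesis by simp
qed

lemma perm_minor_Un: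
  assumes fin: "finite I" "finite J" and disj: "I \<inter> J = {}" and inv: "p ` I = I" "p ` J = J"
  shows "perm_minor p (I \<union> J) = perm_minor p I * perm_minor p J"
proof -
  have perm: "permutation (restrict_id p S)" if "finite S" "p ` S = S" for S
    using that by (intro permutes_imp_permutation[OF _ permutes_restrict_id] image_eq_imp_bij_betw)
  have "restrict_id p (I \<union> J) = restrict_id p I \<circ> restrict_id p J"
    using disj inv(2) by (auto simp: restrict_id_def fun_eq_iff)
  then show ?thesis
    using perm[OF fin(1) inv(1)] perm[OF fin(2) inv(2)] inv
    by (simp add: perm_minor_def sign_on_def sign_compose image_Un)
qed

lemma perm_minor_insert_fixed:
  assumes "inj p" "p x = x" "x \<notin> L"
  shows "perm_minor p (insert x L) = perm_minor p L"
proof -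
  have "p ` insert x L = insert x L \<longleftrightarrow> p ` L = L"
    using assms inj_image_mem_iff[OF assms(1), of x L] by (simp add: insert_ident)
  moreover have "restrict_id p (insert x L) = restrict_id p L"
    using assms by (auto simp: restrict_id_def fun_eq_iff)
  ultimately show ?thesis by (simp add: perm_minor_def sign_on_def)
qed

section \<open>Exchanging one index\<close>

text \<open>
  For \<open>x \<in> I\<close> and \<open>y \<notin> I\<close>, \<open>perm_minor (transpose x y \<circ> p) I\<close> is, up to sign, the minor of the
  permutation matrix of \<open>p\<close> whose column set is \<open>I\<close> and whose row set is \<open>I\<close> with \<open>x\<close> replaced
  by \<open>y\<close>.
\<close>

lemma perm_minor_transpose_comp_insert:
  assumes fin: "finite L" and inj: "inj p" and x: "x \<notin> L" and y: "y \<notin> L"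
  shows "perm_minor (transpose x y \<circ> p) (insert x L) =
    (if p x = y then perm_minor p L
     else if p x \<in> L then - perm_minor (transpose (p x) y \<circ> p) L else 0)"
proof -
  have other: "p v \<noteq> p x" if "v \<in> L" for v using that x inj by (metis injD)
  consider (to_y) "p x = y" | (inside) "p x \<in> L" | (outside) "p x \<noteq> y" "p x \<notin> L" by blast
  then show ?thesis
  proof cases
    case to_y
    have "perm_minor (transpose x y \<circ> p) (insert x L) = perm_minor (transpose x y \<circ> p) L"
      using to_y x inj by (intro perm_minor_insert_fixed inj_compose) auto
    also have "\<dots> = perm_minor p L"
      using other x y to_y by (intro perm_minor_cong) (auto simp: transpose_def)
    finally show ?thesis using to_y by simp
  next
    case inside
    let ?r = "transpose x (p x) \<circ> (transpose x y \<circ> p)"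
    have "p x \<noteq> x" "p x \<noteq> y" using inside x y by auto
    then have "perm_minor (transpose x (p x)) (insert x L) = -1"
      using inside by (intro perm_minor_transpose_inside) auto
    moreover have "transpose x (p x) ` insert x L = insert x L"
      using inside by (intro transpose_image_eq) simp
    ultimately have "perm_minor ?r (insert x L) = - perm_minor (transpose x y \<circ> p) (insert x L)"
      using fin by (subst perm_minor_comp_left) auto
    moreover have "perm_minor ?r (insert x L) = perm_minor ?r L"
      using \<open>p x \<noteq> x\<close> \<open>p x \<noteq> y\<close> x inj by (intro perm_minor_insert_fixed inj_compose) auto
    moreover have "perm_minor ?r L = perm_minor (transpose (p x) y \<circ> p) L"
      using other x y \<open>p x \<noteq> x\<close> \<open>p x \<noteq> y\<close>
      by (intro perm_minor_cong) (auto simp: transpose_def split: if_splits)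
    ultimately show ?thesis using inside \<open>p x \<noteq> y\<close> by simp
  next
    case outside
    then have "(transpose x y \<circ> p) x \<notin> insert x L"
      using x y by (auto simp: transpose_def)
    then show ?thesis using outside by (simp add: perm_minor_eq_0[of x])
  qed
qed

lemma sum_perm_minor_transpose_comp_insert:
  assumes fin: "finite X" and p: "p permutes X" and L: "L \<subseteq> X" and y: "y \<in> X - L"
  shows "(\<Sum>x\<in>X - L. perm_minor (transpose x y \<circ> p) (insert x L)) =
    perm_minor p L - (\<Sum>z\<in>L. perm_minor (transpose z y \<circ> p) L)"
proof -
  define g where "g w = (if w = y then perm_minor p L
    else if w \<in> L then - perm_minor (transpose w y \<circ> p) L else 0)" for w
  have finL: "finite L" using fin L finite_subset by blast
  have "g (p x) = 0" if "x \<in> L" for x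
  proof -
    have "perm_minor (transpose (p x) y \<circ> p) L = 0"
      using that y by (intro perm_minor_eq_0[of x]) auto
    moreover have "perm_minor p L = 0" if "p x = y"
      using that \<open>x \<in> L\<close> y by (intro perm_minor_eq_0[of x]) auto
    ultimately show ?thesis by (simp add: g_def)
  qed
  then have "(\<Sum>x\<in>X - L. g (p x)) = (\<Sum>x\<in>X. g (p x))"
    using fin by (intro sum.mono_neutral_left) auto
  also have "\<dots> = (\<Sum>w\<in>X. g w)"
    using sum.permute[OF p, of g] by simp
  also have "\<dots> = (\<Sum>w\<in>L. g w) + (\<Sum>w\<in>X - L. g w)"
    using sum.subset_diff[OF L fin, of g] by simp
  also have "(\<Sum>w\<in>L. g w) = - (\<Sum>z\<in>L. perm_minor (transpose z y \<circ> p) L)"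
    unfolding sum_negf[symmetric] using y by (intro sum.cong) (auto simp: g_def)
  also have "(\<Sum>w\<in>X - L. g w) = (\<Sum>w\<in>X - L. if w = y then perm_minor p L else 0)"
    by (intro sum.cong) (auto simp: g_def)
  also have "\<dots> = perm_minor p L" using fin y by simp
  finally have "(\<Sum>x\<in>X - L. g (p x)) = perm_minor p L - (\<Sum>z\<in>L. perm_minor (transpose z y \<circ> p) L)"
    by (simp only: minus_add_distrib minus_add_cancel add.commute diff_conv_add_uminus)
  moreover have "perm_minor (transpose x y \<circ> p) (insert x L) = g (p x)" if "x \<in> X - L" for x
    unfolding g_def using that y
    by (intro perm_minor_transpose_comp_insert[OF finL permutes_inj[OF p]]) auto
  ultimately show ?thesis by simp
qed

definition exchange_sum :: "'a set \<Rightarrow> ('a \<Rightarrow> 'a) \<Rightarrow> 'a set \<Rightarrow> int" where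
  "exchange_sum X p I = (\<Sum>x\<in>I. \<Sum>y\<in>X - I. perm_minor (transpose x y \<circ> p) I)"

lemma exchange_sum_plus_card:
  assumes fin: "finite X" and I: "I \<subseteq> X"
  shows "exchange_sum X p I + int (card I) * perm_minor p I =
    (\<Sum>x\<in>I. \<Sum>y\<in>X - (I - {x}). perm_minor (transpose x y \<circ> p) I)"
proof -
  have "(\<Sum>y\<in>X - (I - {x}). perm_minor (transpose x y \<circ> p) I) =
      (\<Sum>y\<in>X - I. perm_minor (transpose x y \<circ> p) I) + perm_minor p I" if "x \<in> I" for x
  proof -
    have "X - (I - {x}) = insert x (X - I)" using that I by auto
    then show ?thesis using that fin by simp
  qed
  then show ?thesis by (simp add: exchange_sum_def sum.distrib)
qed

lemma sum_exchanges_insert: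
  assumes fin: "finite X" and p: "p permutes X" and L: "L \<subseteq> X"
  shows "(\<Sum>x\<in>X - L. \<Sum>y\<in>X - L. perm_minor (transpose x y \<circ> p) (insert x L)) =
    int (card X - card L) * perm_minor p L - exchange_sum X p L"
proof -
  have "(\<Sum>x\<in>X - L. \<Sum>y\<in>X - L. perm_minor (transpose x y \<circ> p) (insert x L)) =
      (\<Sum>y\<in>X - L. perm_minor p L - (\<Sum>z\<in>L. perm_minor (transpose z y \<circ> p) L))"
    by (subst sum.swap) (intro sum.cong refl sum_perm_minor_transpose_comp_insert[OF fin p L])
  also have "\<dots> = int (card (X - L)) * perm_minor p L - exchange_sum X p L"
    by (simp add: sum_subtractf exchange_sum_def sum.swap[of _ L])
  also have "card (X - L) = card X - card L"
    using L fin by (simp add: card_Diff_subset finite_subset)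
  finally show ?thesis .
qed

lemma perm_minor_transpose_comp_eq_0:
  assumes "x \<in> I" "y \<notin> I" "p ` I \<noteq> insert y (I - {x})"
  shows "perm_minor (transpose x y \<circ> p) I = 0"
  unfolding perm_minor_def transpose_comp_image_eq_iff
  using assms by (simp add: transpose_image_exchange)

lemma exchange_sum_eq_0:
  assumes "\<And>x y. x \<in> I \<Longrightarrow> y \<in> X - I \<Longrightarrow> p ` I \<noteq> insert y (I - {x})"
  shows "exchange_sum X p I = 0"
  unfolding exchange_sum_def
  using assms by (intro sum.neutral ballI perm_minor_transpose_comp_eq_0) auto

lemma exchange_sum_eq_perm_minor:
  assumes fin: "finite X" and I: "I \<subseteq> X" and x: "x \<in> I" and y: "y \<in> X - I"
    and exchange: "p ` I = insert y (I - {x})"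
  shows "exchange_sum X p I = perm_minor (transpose x y \<circ> p) I"
proof -
  have "perm_minor (transpose x' y' \<circ> p) I = 0"
    if "x' \<in> I" "y' \<in> X - I" "(x', y') \<noteq> (x, y)" for x' y'
    using that x y exchange by (intro perm_minor_transpose_comp_eq_0) auto
  then have "(\<Sum>(x', y')\<in>I \<times> (X - I). perm_minor (transpose x' y' \<circ> p) I) =
      (\<Sum>(x', y')\<in>{(x, y)}. perm_minor (transpose x' y' \<circ> p) I)"
    using x y fin finite_subset[OF I] by (intro sum.mono_neutral_right) auto
  then show ?thesis by (simp add: exchange_sum_def sum.cartesian_product)
qed

section \<open>Hook characters\<close>

text \<open>
  \<open>exterior_char X k\<close> is the character of the \<open>k\<close>-th exterior power of the permutation
  representation of \<open>Sym X\<close>, and \<open>hook_char X k\<close> that of the standard representation. With \<open>s\<close>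
  the sum of the basis vectors and \<open>\<iota>\<close> the contraction by the coordinate sum, \<open>exchange_char X k p\<close>
  is the trace of \<open>p\<close> composed with the off-diagonal part of \<open>s \<and> \<iota>\<close>; the diagonal part is
  multiplication by \<open>k\<close>. The recursion for it expresses the relation \<open>s \<and> \<iota> + \<iota> (s \<and> _) = n\<close>.
\<close>

definition exterior_char :: "'a set \<Rightarrow> nat \<Rightarrow> ('a \<Rightarrow> 'a) \<Rightarrow> int" where
  "exterior_char X k p = (\<Sum>I | I \<subseteq> X \<and> card I = k. perm_minor p I)"

definition exchange_char :: "'a set \<Rightarrow> nat \<Rightarrow> ('a \<Rightarrow> 'a) \<Rightarrow> int" where
  "exchange_char X k p = (\<Sum>I | I \<subseteq> X \<and> card I = k. exchange_sum X p I)"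

primrec hook_char :: "'a set \<Rightarrow> nat \<Rightarrow> ('a \<Rightarrow> 'a) \<Rightarrow> int" where
  "hook_char X 0 p = exterior_char X 0 p"
| "hook_char X (Suc k) p = exterior_char X (Suc k) p - hook_char X k p"

lemma sum_subsets_card_Suc:
  fixes f :: "'a set \<Rightarrow> 'a \<Rightarrow> 'b :: comm_monoid_add"
  assumes fin: "finite X"
  shows "(\<Sum>I | I \<subseteq> X \<and> card I = Suc k. \<Sum>x\<in>I. f I x) =
    (\<Sum>L | L \<subseteq> X \<and> card L = k. \<Sum>x\<in>X - L. f (insert x L) x)"
proof -
  have finite_sub: "finite I" if "I \<subseteq> X" for I using that fin finite_subset by blast
  have "(\<Sum>I | I \<subseteq> X \<and> card I = Suc k. \<Sum>x\<in>I. f I x) =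
    (\<Sum>(I, x)\<in>(SIGMA I:{I. I \<subseteq> X \<and> card I = Suc k}. I). f I x)"
    using fin finite_sub by (subst sum.Sigma) auto
  also have "\<dots> = (\<Sum>(L, x)\<in>(SIGMA L:{L. L \<subseteq> X \<and> card L = k}. X - L). f (insert x L) x)"
    by (rule sum.reindex_bij_witness
        [where i = "\<lambda>(L, x). (insert x L, x)" and j = "\<lambda>(I, x). (I - {x}, x)"])
      (auto simp: insert_absorb card_insert_if finite_sub)
  also have "\<dots> = (\<Sum>L | L \<subseteq> X \<and> card L = k. \<Sum>x\<in>X - L. f (insert x L) x)"
    using fin finite_sub by (subst sum.Sigma) auto
  finally show ?thesis .
qed

lemma exchange_char_Suc:
  assumes fin: "finite X" and p: "p permutes X"
  shows "exchange_char X (Suc k) p + int (Suc k) * exterior_char X (Suc k) p =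
    int (card X - k) * exterior_char X k p - exchange_char X k p"
proof -
  let ?S = "\<lambda>k. {I. I \<subseteq> X \<and> card I = k}"
  let ?r = "\<lambda>x y. perm_minor (transpose x y \<circ> p)"
  have "exchange_char X (Suc k) p + int (Suc k) * exterior_char X (Suc k) p =
      (\<Sum>I\<in>?S (Suc k). exchange_sum X p I + int (card I) * perm_minor p I)"
    unfolding exchange_char_def exterior_char_def sum_distrib_left sum.distrib[symmetric]
    by (intro sum.cong) auto
  also have "\<dots> = (\<Sum>I\<in>?S (Suc k). \<Sum>x\<in>I. \<Sum>y\<in>X - (I - {x}). ?r x y I)"
    by (intro sum.cong refl exchange_sum_plus_card[OF fin]) auto
  also have "\<dots> = (\<Sum>L\<in>?S k. \<Sum>x\<in>X - L. \<Sum>y\<in>X - (insert x L - {x}). ?r x y (insert x L))"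
    by (rule sum_subsets_card_Suc[OF fin])
  also have "\<dots> = (\<Sum>L\<in>?S k. \<Sum>x\<in>X - L. \<Sum>y\<in>X - L. ?r x y (insert x L))"
    by (intro sum.cong refl) auto
  also have "\<dots> = (\<Sum>L\<in>?S k. int (card X - k) * perm_minor p L - exchange_sum X p L)"
    using sum_exchanges_insert[OF fin p] by (intro sum.cong refl) auto
  also have "\<dots> = int (card X - k) * exterior_char X k p - exchange_char X k p"
    unfolding exchange_char_def exterior_char_def by (simp add: sum_subtractf sum_distrib_left)
  finally show ?thesis .
qed

lemma subsets_card_0: "finite X \<Longrightarrow> {I. I \<subseteq> X \<and> card I = 0} = {{}}"
  by (auto dest: finite_subset)

lemma exterior_char_0 [simp]: "finite X \<Longrightarrow> exterior_char X 0 p = 1"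
  unfolding exterior_char_def by (simp only: subsets_card_0) simp

lemma exchange_char_0 [simp]: "finite X \<Longrightarrow> exchange_char X 0 p = 0"
  unfolding exchange_char_def by (simp only: subsets_card_0) (simp add: exchange_sum_def)

lemma card_times_hook_char:
  assumes fin: "finite X" and p: "p permutes X" and "k \<le> card X"
  shows "int (card X) * hook_char X k p =
    exchange_char X (Suc k) p + int (Suc k) * exterior_char X (Suc k) p"
  using \<open>k \<le> card X\<close>
proof (induction k)
  case 0
  then show ?case using exchange_char_Suc[OF fin p, of 0] fin by simp
next
  case (Suc k)
  then have "int (card X) * hook_char X (Suc k) p =
      int (card X - Suc k) * exterior_char X (Suc k) p - exchange_char X (Suc k) p"
    by (simp add: algebra_simps)
  then show ?case using exchange_char_Suc[OF fin p, of "Suc k"] by simp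
qed

lemma exchange_char_eq_hook_chars:
  assumes fin: "finite X" and p: "p permutes X" and "k < card X"
  shows "exchange_char X (Suc k) p =
    int (card X - Suc k) * hook_char X k p - int (Suc k) * hook_char X (Suc k) p"
  using card_times_hook_char[OF fin p, of k] \<open>k < card X\<close> by (simp add: algebra_simps)

lemma hook_char_id:
  assumes fin: "finite X" and k: "k < card X"
  shows "hook_char X k id = int ((card X - 1) choose k)"
proof -
  have "exchange_char X (Suc k) id = 0"
    unfolding exchange_char_def by (intro sum.neutral ballI exchange_sum_eq_0) auto
  moreover have "exterior_char X (Suc k) id = int (card X choose Suc k)"
    unfolding exterior_char_def by (simp add: n_subsets[OF fin])
  ultimately have "int (card X) * hook_char X k id = int (Suc k * (card X choose Suc k))"
    using card_times_hook_char[OF fin permutes_id, of k] k by (simp add: distrib_right)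
  also have "\<dots> = int (card X) * int ((card X - 1) choose k)"
    using k Suc_times_binomial_eq[of "card X - 1" k] by (simp add: algebra_simps flip: of_nat_mult)
  finally show ?thesis using k by simp
qed

section \<open>Translation by the full cycles\<close>

lemma sum_eq_0_sign_reversing:
  fixes f :: "'a \<Rightarrow> 'b :: linordered_ab_group_add"
  assumes "\<And>a. a \<in> A \<Longrightarrow> h a \<in> A" "\<And>a. a \<in> A \<Longrightarrow> h (h a) = a"
    and "\<And>a. a \<in> A \<Longrightarrow> f (h a) = - f a"
  shows "sum f A = 0"
proof -
  have "sum f A = (\<Sum>a\<in>A. f (h a))"
    by (rule sum.reindex_bij_witness[where i = h and j = h]) (use assms in auto)
  also have "\<dots> = - sum f A"
    unfolding sum_negf[symmetric] using assms(3) by (intro sum.cong) auto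
  finally show ?thesis by simp
qed

lemma sum_cyclic_perms_perm_minor_comp_transpose:
  assumes fin: "finite X" and I: "I \<subseteq> X" and x: "x \<in> I" and y: "y \<in> X - I"
  shows "(\<Sum>a\<in>cyclic_perms X. perm_minor (a \<circ> transpose x y) I) =
    (-1) ^ (card I - 1) * fact (card I - 1) * fact (card X - card I - 1)"
proof -
  let ?t = "transpose x y"
  let ?A = "{a \<in> cyclic_perms X. (a \<circ> ?t) ` I = I}"
  have finI: "finite I" using I fin finite_subset by auto
  have t: "?t permutes X" using x y I by (intro permutes_swap_id) auto
  have minor: "perm_minor (a \<circ> ?t) I = (-1) ^ (card I - 1)" if a: "a \<in> ?A" for a
  proof -
    have perm: "a \<circ> ?t permutes X"
      using a cyclic_perms_permutes by (intro permutes_compose[OF t]) blast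
    have "cyclic_on (a \<circ> ?t \<circ> ?t) X" using a by (simp add: comp_assoc cyclic_perms_cyclic_on)
    then have "cyclic_on (a \<circ> ?t) I"
      using cyclic_on_comp_transpose_iff[OF perm _ fin I x y] a by blast
    moreover have "permutation (a \<circ> ?t)" using perm fin permutes_imp_permutation by blast
    ultimately have "sign_on I (a \<circ> ?t) = (-1) ^ (card I - 1)" by (intro sign_on_cyclic)
    then show ?thesis using a by (simp add: perm_minor_def)
  qed
  have "(\<Sum>a\<in>cyclic_perms X. perm_minor (a \<circ> ?t) I) = (\<Sum>a\<in>?A. perm_minor (a \<circ> ?t) I)"
    using finite_cyclic_perms[OF fin] by (intro sum.mono_neutral_right) (auto simp: perm_minor_def)
  also have "\<dots> = int (card ?A) * (-1) ^ (card I - 1)"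
    by (simp only: sum.cong[OF refl minor] sum_constant)
  also have "int (card ?A) = fact (card I - 1) * fact (card X - card I - 1)"
  proof -
    have "I \<noteq> {}" "X - I \<noteq> {}" using x y by auto
    then show ?thesis
      using fin finI I unfolding card_cyclic_perms_split[OF fin I x y]
      by (simp add: card_cyclic_perms card_Diff_subset)
  qed
  finally show ?thesis by (simp only: mult_ac)
qed

lemma sum_cyclic_perms_perm_minor_exchange:
  assumes fin: "finite X" and I: "I \<subseteq> X" and x: "x \<in> I" and y: "y \<in> X - I"
    and exchange: "u ` I = insert y (I - {x})"
  shows "(\<Sum>a\<in>cyclic_perms X. perm_minor (a \<circ> u) I) =
    (-1) ^ (card I - 1) * fact (card I - 1) * fact (card X - card I - 1) * exchange_sum X u I"
proof -
  let ?t = "transpose x y"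
  have finI: "finite I" using I fin finite_subset by auto
  have invariant: "(?t \<circ> u) ` I = I"
    unfolding transpose_comp_image_eq_iff exchange using x y by (simp add: transpose_image_exchange)
  have "perm_minor (a \<circ> u) I = perm_minor (a \<circ> ?t) I * perm_minor (?t \<circ> u) I" for a
  proof -
    have "a \<circ> u = (a \<circ> ?t) \<circ> (?t \<circ> u)" by (simp add: fun_eq_iff)
    then show ?thesis by (simp only: perm_minor_comp_right[OF finI invariant])
  qed
  then have "(\<Sum>a\<in>cyclic_perms X. perm_minor (a \<circ> u) I) =
      (\<Sum>a\<in>cyclic_perms X. perm_minor (a \<circ> ?t) I * perm_minor (?t \<circ> u) I)"
    by (intro sum.cong refl)
  also have "\<dots> = (\<Sum>a\<in>cyclic_perms X. perm_minor (a \<circ> ?t) I) * exchange_sum X u I"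
    by (simp only: sum_distrib_right exchange_sum_eq_perm_minor[OF fin I x y exchange])
  finally show ?thesis
    by (simp only: sum_cyclic_perms_perm_minor_comp_transpose[OF fin I x y])
qed

text \<open>Conjugation by the transposition of \<open>u v\<close> and \<open>u w\<close> reverses signs.\<close>

lemma sum_cyclic_perms_perm_minor_eq_0:
  assumes fin: "finite X" and u: "u permutes X" and I: "I \<subseteq> X"
    and escape: "v \<in> I" "w \<in> I" "u v \<noteq> u w" "u v \<notin> I" "u w \<notin> I"
  shows "(\<Sum>a\<in>cyclic_perms X. perm_minor (a \<circ> u) I) = 0"
proof (rule sum_eq_0_sign_reversing)
  let ?t = "transpose (u v) (u w)"
  let ?s = "transpose v w"
  have finI: "finite I" using I fin finite_subset by auto
  have t: "?t permutes X"
    using escape I permutes_in_image[OF u] by (intro permutes_swap_id) auto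
  fix a assume "a \<in> cyclic_perms X"
  then show "?t \<circ> a \<circ> ?t \<in> cyclic_perms X"
    using conj_cyclic_perms[OF _ t] by simp
  show "?t \<circ> (?t \<circ> a \<circ> ?t) \<circ> ?t = a" by (simp add: fun_eq_iff)
  have inside: "perm_minor ?s I = -1"
    using escape(1-3) by (intro perm_minor_transpose_inside) auto
  have outside: "perm_minor ?t I = 1"
    using escape(4,5) by (rule perm_minor_transpose_outside)
  have invariant: "?s ` I = I" "?t ` I = I" using escape by simp_all
  have "?t \<circ> a \<circ> ?t \<circ> u = (?t \<circ> (a \<circ> u)) \<circ> ?s"
    using permutes_inj[OF u] by (auto simp: fun_eq_iff transpose_def inj_eq)
  then show "perm_minor (?t \<circ> a \<circ> ?t \<circ> u) I = - perm_minor (a \<circ> u) I"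
    using perm_minor_comp_right[OF finI invariant(1), of "?t \<circ> (a \<circ> u)"]
      perm_minor_comp_left[OF finI inj_transpose invariant(2), of "a \<circ> u"]
    by (simp only: inside outside)
qed

lemma sum_cyclic_perms_perm_minor:
  assumes fin: "finite X" and u: "u permutes X" and I: "I \<subseteq> X" "I \<noteq> {}" "I \<noteq> X"
  shows "(\<Sum>a\<in>cyclic_perms X. perm_minor (a \<circ> u) I) =
    (-1) ^ (card I - 1) * fact (card I - 1) * fact (card X - card I - 1) * exchange_sum X u I"
proof -
  have finI: "finite I" using I fin finite_subset by auto
  have card_u: "card (u ` I) = card I"
    using permutes_inj[OF u] by (simp add: card_image inj_on_subset)
  consider (invariant) "u ` I \<subseteq> I" | (exchange) y where "u ` I - I = {y}"
    | (escape) v w where "v \<in> I" "w \<in> I" "u v \<noteq> u w" "u v \<notin> I" "u w \<notin> I"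
    by blast
  then show ?thesis
  proof cases
    case invariant
    then have uI: "u ` I = I" using card_u finI by (simp add: card_subset_eq)
    have "perm_minor (a \<circ> u) I = 0" if "a \<in> cyclic_perms X" for a
    proof -
      have "(a \<circ> u) ` I = a ` I" using uI by (metis image_comp)
      moreover have "a ` I \<noteq> I"
        using cyclic_on_invariant_subset[OF cyclic_perms_cyclic_on[OF that]] I by blast
      ultimately show ?thesis by (simp add: perm_minor_def)
    qed
    moreover have "exchange_sum X u I = 0" using uI by (intro exchange_sum_eq_0) auto
    ultimately show ?thesis by simp
  next
    case (exchange y)
    have "card (I - u ` I) = card (u ` I - I)"
      using card_u finI by (metis card_le_sym_Diff finite_imageI le_antisym order_refl)
    then obtain x where "I - u ` I = {x}" using exchange by (auto simp: card_1_singleton_iff)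
    then have "u ` I = insert y (I - {x})" "x \<in> I" using exchange by auto
    moreover have "u ` I \<subseteq> X" using I permutes_in_image[OF u] by auto
    then have "y \<in> X - I" using exchange by blast
    ultimately show ?thesis by (intro sum_cyclic_perms_perm_minor_exchange[OF fin I(1)])
  next
    case (escape v w)
    then have "exchange_sum X u I = 0" by (intro exchange_sum_eq_0) (metis DiffD1 imageI insertE)
    then show ?thesis using sum_cyclic_perms_perm_minor_eq_0[OF fin u I(1) escape] by simp
  qed
qed

lemma sum_cyclic_perms_exterior_char:
  assumes fin: "finite X" and u: "u permutes X" and k: "0 < k" "k < card X"
  shows "(\<Sum>a\<in>cyclic_perms X. exterior_char X k (a \<circ> u)) =
    (-1) ^ (k - 1) * fact (k - 1) * fact (card X - k - 1) * exchange_char X k u"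
proof -
  have "(\<Sum>a\<in>cyclic_perms X. exterior_char X k (a \<circ> u)) =
    (\<Sum>I | I \<subseteq> X \<and> card I = k. \<Sum>a\<in>cyclic_perms X. perm_minor (a \<circ> u) I)"
    unfolding exterior_char_def by (rule sum.swap)
  also have "\<dots> = (\<Sum>I | I \<subseteq> X \<and> card I = k.
     (-1) ^ (k - 1) * fact (k - 1) * fact (card X - k - 1) * exchange_sum X u I)"
  proof (intro sum.cong refl)
    fix I assume "I \<in> {I. I \<subseteq> X \<and> card I = k}"
    then have I: "I \<subseteq> X" "card I = k" by auto
    then have "I \<noteq> {}" "I \<noteq> X" using k by auto
    from sum_cyclic_perms_perm_minor[OF fin u I(1) this]
    show "(\<Sum>a\<in>cyclic_perms X. perm_minor (a \<circ> u) I) =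
      (-1) ^ (k - 1) * fact (k - 1) * fact (card X - k - 1) * exchange_sum X u I"
      unfolding I(2) .
  qed
  finally show ?thesis unfolding exchange_char_def by (simp add: sum_distrib_left)
qed

definition hook_eigenvalue :: "nat \<Rightarrow> nat \<Rightarrow> int" where
  "hook_eigenvalue n k = (-1) ^ k * fact k * fact (n - 1 - k)"

lemma sum_cyclic_perms_exterior_char_Suc:
  assumes fin: "finite X" and u: "u permutes X" and k: "Suc k < card X"
  shows "(\<Sum>a\<in>cyclic_perms X. exterior_char X (Suc k) (a \<circ> u)) =
    hook_eigenvalue (card X) k * hook_char X k u
      + hook_eigenvalue (card X) (Suc k) * hook_char X (Suc k) u"
proof -
  let ?n = "card X"
  define c :: int where "c = (-1) ^ k * fact k * fact (?n - Suc k - 1)"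
  have "fact (?n - 1 - k) = (int (?n - Suc k) * fact (?n - Suc k - 1) :: int)"
    using k by (subst fact_reduce) auto
  then have eigenvalue_k: "hook_eigenvalue ?n k = c * int (?n - Suc k)"
    by (simp add: c_def hook_eigenvalue_def)
  have eigenvalue_Suc: "hook_eigenvalue ?n (Suc k) = - (c * int (Suc k))"
    by (simp add: c_def hook_eigenvalue_def algebra_simps)
  have "(\<Sum>a\<in>cyclic_perms X. exterior_char X (Suc k) (a \<circ> u)) = c * exchange_char X (Suc k) u"
    using sum_cyclic_perms_exterior_char[OF fin u, of "Suc k"] k by (simp add: c_def)
  also have "exchange_char X (Suc k) u =
      int (?n - Suc k) * hook_char X k u - int (Suc k) * hook_char X (Suc k) u"
    using k by (intro exchange_char_eq_hook_chars[OF fin u]) simp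
  finally show ?thesis
    unfolding eigenvalue_k eigenvalue_Suc by (simp only: right_diff_distrib) (simp add: mult.assoc)
qed

lemma sum_cyclic_perms_hook_char:
  assumes fin: "finite X" and u: "u permutes X" and "k < card X"
  shows "(\<Sum>a\<in>cyclic_perms X. hook_char X k (a \<circ> u)) =
    hook_eigenvalue (card X) k * hook_char X k u"
  using \<open>k < card X\<close>
proof (induction k)
  case 0
  then have "X \<noteq> {}" by auto
  then show ?case using fin card_cyclic_perms[OF fin] by (simp add: hook_eigenvalue_def)
next
  case (Suc k)
  then show ?case
    using sum_cyclic_perms_exterior_char_Suc[OF fin u, of k]
    by (simp add: sum_subtractf del: o_apply)
qed

section \<open>Alternating sum of the hook characters\<close>

lemma signed_perm_minor_Un_cycle:
  assumes "permutation p" "cyclic_on p Q" "finite I" "p ` I = I" "I \<inter> Q = {}"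
  shows "(-1) ^ card (I \<union> Q) * perm_minor p (I \<union> Q) = - ((-1) ^ card I * perm_minor p I)"
proof -
  have finQ: "finite Q" using assms(2) by (rule finite_cyclic_on)
  have pQ: "p ` Q = Q" using assms(1,2) by (rule cyclic_on_image_eq)
  have "card Q > 0" using finQ assms(2) by (simp add: card_gt_0_iff cyclic_on_alldef)
  moreover have "perm_minor p Q = (-1) ^ (card Q - 1)"
    using sign_on_cyclic[OF assms(1,2)] pQ by (simp add: perm_minor_def)
  ultimately have "(-1) ^ card Q * perm_minor p Q = -1"
    by (cases "card Q") (auto simp flip: power_mult_distrib)
  moreover have "(-1) ^ card (I \<union> Q) * perm_minor p (I \<union> Q) =
      ((-1) ^ card I * perm_minor p I) * ((-1) ^ card Q * perm_minor p Q)"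
    using assms finQ pQ by (simp add: perm_minor_Un card_Un_disjoint power_add)
  ultimately show ?thesis by simp
qed

lemma sum_signed_perm_minor_eq_0:
  assumes fin: "finite S" and p: "permutation p" and Q: "cyclic_on p Q" "Q \<subseteq> S"
  shows "(\<Sum>I\<in>Pow S. (-1) ^ card I * perm_minor p I) = 0"
proof -
  let ?w = "\<lambda>I. (-1) ^ card I * perm_minor p I"
  let ?Inv = "{I. I \<subseteq> S \<and> p ` I = I}"
  have inj: "inj p" using p permutation_bijective bij_is_inj by blast
  have pQ: "p ` Q = Q" using p Q(1) by (rule cyclic_on_image_eq)
  have "(\<Sum>I\<in>Pow S. ?w I) = (\<Sum>I\<in>?Inv. ?w I)"
    using fin by (intro sum.mono_neutral_right) (auto simp: perm_minor_def)
  also have "\<dots> = 0"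
  proof (rule sum_eq_0_sign_reversing)
    fix I assume I: "I \<in> ?Inv"
    then have finI: "finite I" using fin finite_subset by auto
    show "sym_diff I Q \<in> ?Inv"
      using I Q(2) pQ by (auto simp: image_Un image_set_diff[OF inj])
    show "sym_diff (sym_diff I Q) Q = I" by blast
    have "p ` (I \<inter> Q) = I \<inter> Q" using I pQ by (simp add: image_Int[OF inj])
    then consider (disjoint) "I \<inter> Q = {}" | (contains) "Q \<subseteq> I"
      using cyclic_on_invariant_subset[OF Q(1), of "I \<inter> Q"] by blast
    then show "?w (sym_diff I Q) = - ?w I"
    proof cases
      case disjoint
      then have "sym_diff I Q = I \<union> Q" by blast
      then show ?thesis using signed_perm_minor_Un_cycle[OF p Q(1) finI] I disjoint by simp
    next
      case contains
      then have "sym_diff I Q = I - Q" "(I - Q) \<union> Q = I" "(I - Q) \<inter> Q = {}" by blast+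
      moreover have "p ` (I - Q) = I - Q" using I pQ by (simp add: image_set_diff[OF inj])
      ultimately show ?thesis using signed_perm_minor_Un_cycle[OF p Q(1), of "I - Q"] finI by simp
    qed
  qed
  finally show ?thesis .
qed

lemma sum_signed_perm_minor_avoiding:
  assumes fin: "finite X" and p: "p permutes X" and x: "x \<in> X"
  shows "(\<Sum>I\<in>Pow (X - {x}). (-1) ^ card I * perm_minor p I) = (if p \<in> cyclic_perms X then 1 else 0)"
proof (cases "p \<in> cyclic_perms X")
  case True
  have "perm_minor p I = 0" if "I \<subseteq> X - {x}" "I \<noteq> {}" for I
    using cyclic_on_invariant_subset[OF cyclic_perms_cyclic_on[OF True], of I] that x
    by (auto simp: perm_minor_def)
  then have "(\<Sum>I\<in>Pow (X - {x}). (-1) ^ card I * perm_minor p I) =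
      (\<Sum>I\<in>{{}}. (-1) ^ card I * perm_minor p I)"
    using fin by (intro sum.mono_neutral_right) auto
  then show ?thesis using True by simp
next
  case False
  have perm: "permutation p" using p fin permutes_imp_permutation by blast
  have "orbit p x \<noteq> X" using False p x by (auto simp: cyclic_perms_def intro: cyclic_on_singleI)
  then obtain y where y: "y \<in> X" "y \<notin> orbit p x"
    using permutes_orbit_subset[OF p x] by blast
  have "x \<notin> orbit p y"
    using y(2) orbit_swap[OF permutation_self_in_orbit[OF perm]] by blast
  then have "orbit p y \<subseteq> X - {x}" using permutes_orbit_subset[OF p y(1)] by blast
  then show ?thesis
    using False fin sum_signed_perm_minor_eq_0[OF _ perm cyclic_on_orbit'[OF perm]] by simp
qed

lemma sum_signed_hook_char:
  "(\<Sum>k<m. (-1) ^ k * hook_char X k p) = (\<Sum>k<m. int (m - k) * ((-1) ^ k * exterior_char X k p))"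
proof (induction m)
  case (Suc m)
  have hook: "(-1) ^ k * hook_char X k p = (\<Sum>j<Suc k. (-1) ^ j * exterior_char X j p)" for k
    by (induction k) (auto simp: algebra_simps)
  have "(\<Sum>k<Suc m. int (Suc m - k) * ((-1) ^ k * exterior_char X k p)) =
      (\<Sum>k<Suc m. int (m - k) * ((-1) ^ k * exterior_char X k p) + (-1) ^ k * exterior_char X k p)"
    by (intro sum.cong refl) (simp add: Suc_diff_le algebra_simps)
  also have "\<dots> = (\<Sum>k<m. int (m - k) * ((-1) ^ k * exterior_char X k p))
      + (-1) ^ m * hook_char X m p"
    unfolding sum.distrib hook by simp
  finally show ?case using Suc.IH by simp
qed simp

lemma sum_Pow_complement_card:
  fixes f :: "'a set \<Rightarrow> 'b :: comm_semiring_1"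
  assumes fin: "finite X"
  shows "(\<Sum>I\<in>Pow X. of_nat (card X - card I) * f I) = (\<Sum>x\<in>X. \<Sum>I\<in>Pow (X - {x}). f I)"
proof -
  have "(\<Sum>I\<in>Pow X. of_nat (card X - card I) * f I) = (\<Sum>I\<in>Pow X. \<Sum>x\<in>{x \<in> X. x \<notin> I}. f I)"
  proof (intro sum.cong refl)
    fix I assume "I \<in> Pow X"
    then have "card {x \<in> X. x \<notin> I} = card X - card I"
      using fin unfolding set_diff_eq[symmetric]
      by (intro card_Diff_subset) (auto intro: finite_subset)
    then show "of_nat (card X - card I) * f I = (\<Sum>x\<in>{x \<in> X. x \<notin> I}. f I)" by simp
  qed
  also have "\<dots> = (\<Sum>x\<in>X. \<Sum>I\<in>{I \<in> Pow X. x \<notin> I}. f I)"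
    using fin by (intro sum.swap_restrict) auto
  also have "\<dots> = (\<Sum>x\<in>X. \<Sum>I\<in>Pow (X - {x}). f I)"
    by (intro sum.cong refl) auto
  finally show ?thesis .
qed

lemma alternating_sum_hook_char:
  assumes fin: "finite X" and p: "p permutes X"
  shows "(\<Sum>k<card X. (-1) ^ k * hook_char X k p) = (if p \<in> cyclic_perms X then int (card X) else 0)"
proof -
  let ?n = "card X"
  let ?w = "\<lambda>I. (-1) ^ card I * perm_minor p I"
  have "(\<Sum>k<?n. (-1) ^ k * hook_char X k p) =
      (\<Sum>k<?n. int (?n - k) * ((-1) ^ k * exterior_char X k p))"
    by (rule sum_signed_hook_char)
  also have "\<dots> = (\<Sum>k\<le>?n. int (?n - k) * ((-1) ^ k * exterior_char X k p))"
    by (simp add: lessThan_Suc_atMost[symmetric])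
  also have "\<dots> = (\<Sum>k\<le>?n. \<Sum>I\<in>{I \<in> Pow X. card I = k}. int (?n - card I) * ?w I)"
    unfolding exterior_char_def sum_distrib_left by (intro sum.cong) auto
  also have "\<dots> = (\<Sum>I\<in>Pow X. int (?n - card I) * ?w I)"
    using fin by (intro sum.group) (auto intro: card_mono)
  also have "\<dots> = (\<Sum>x\<in>X. \<Sum>I\<in>Pow (X - {x}). ?w I)"
    by (rule sum_Pow_complement_card[OF fin])
  also have "\<dots> = (\<Sum>x\<in>X. if p \<in> cyclic_perms X then 1 else 0)"
    by (intro sum.cong refl sum_signed_perm_minor_avoiding[OF fin p])
  finally show ?thesis by simp
qed

section \<open>Traces of powers and eigenvalues\<close>

definition mat_trace :: "'a :: comm_monoid_add mat \<Rightarrow> 'a" where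
  "mat_trace A = (\<Sum>i<dim_row A. A $$ (i, i))"

lemma mat_trace_mult_comm:
  fixes A B :: "'a :: comm_semiring_0 mat"
  assumes "A \<in> carrier_mat n m" "B \<in> carrier_mat m n"
  shows "mat_trace (A * B) = mat_trace (B * A)"
proof -
  have "mat_trace (A * B) = (\<Sum>i<n. \<Sum>j = 0..<m. A $$ (i, j) * B $$ (j, i))"
    using assms by (simp add: mat_trace_def scalar_prod_def)
  also have "\<dots> = (\<Sum>j = 0..<m. \<Sum>i<n. A $$ (i, j) * B $$ (j, i))"
    by (rule sum.swap)
  also have "\<dots> = mat_trace (B * A)"
    using assms by (simp add: mat_trace_def scalar_prod_def mult.commute atLeast0LessThan)
  finally show ?thesis .
qed

lemma mat_trace_similar:
  fixes A :: "'a :: comm_semiring_1 mat"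
  assumes "similar_mat_wit A B P Q"
  shows "mat_trace A = mat_trace B"
proof -
  obtain n where n: "n = dim_row A" by simp
  note wit = similar_mat_witD[OF n assms]
  have "mat_trace A = mat_trace (P * (B * Q))"
    using wit by (simp add: assoc_mult_mat[of P n n B n Q n])
  also have "\<dots> = mat_trace (B * Q * P)"
    using wit by (intro mat_trace_mult_comm[of _ n n]) auto
  also have "B * Q * P = B"
    using wit by (simp add: assoc_mult_mat[of B n n Q n P n])
  finally show ?thesis .
qed

lemma upper_triangular_mult:
  fixes A B :: "'a :: semiring_0 mat"
  assumes A: "A \<in> carrier_mat n n" "upper_triangular A"
    and B: "B \<in> carrier_mat n n" "upper_triangular B"
  shows "upper_triangular (A * B)"
    and "i < n \<Longrightarrow> (A * B) $$ (i, i) = A $$ (i, i) * B $$ (i, i)"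
proof -
  have entry: "(A * B) $$ (i, j) = (\<Sum>l = 0..<n. A $$ (i, l) * B $$ (l, j))"
    if "i < n" "j < n" for i j
    using A B that by (simp add: scalar_prod_def)
  have zero: "A $$ (i, l) * B $$ (l, j) = 0" if "i < n" "l < n" "l < i \<or> j < l" for i j l
    using that A B by (auto simp: upper_triangular_def)
  show "upper_triangular (A * B)"
  proof (rule upper_triangularI)
    fix i j assume "j < i" "i < dim_row (A * B)"
    then have "i < n" "j < n" using A(1) by auto
    then show "(A * B) $$ (i, j) = 0"
      unfolding entry[OF \<open>i < n\<close> \<open>j < n\<close>] using \<open>j < i\<close> by (intro sum.neutral ballI zero) auto
  qed
  show "(A * B) $$ (i, i) = A $$ (i, i) * B $$ (i, i)" if "i < n"
  proof -
    have "(\<Sum>l = 0..<n. A $$ (i, l) * B $$ (l, i)) = (\<Sum>l\<in>{i}. A $$ (i, l) * B $$ (l, i))"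
      using that by (intro sum.mono_neutral_right ballI zero) auto
    then show ?thesis using that by (simp add: entry)
  qed
qed

lemma upper_triangular_pow:
  fixes B :: "'a :: comm_semiring_1 mat"
  assumes B: "B \<in> carrier_mat n n" "upper_triangular B"
  shows "upper_triangular (B ^\<^sub>m k) \<and> (\<forall>i<n. (B ^\<^sub>m k) $$ (i, i) = B $$ (i, i) ^ k)"
proof (induction k)
  case (Suc k)
  then show ?case
    using upper_triangular_mult[of "B ^\<^sub>m k" n B] B by (simp add: mult.commute)
qed (use B in auto)

lemma proots_prod_list_linear:
  fixes as :: "'a :: field list"
  shows "proots (\<Prod>a\<leftarrow>as. [:- a, 1:]) = mset as"
proof (induction as)
  case (Cons a as)
  have "(\<Prod>a\<leftarrow>as. [:- a, 1:]) \<noteq> 0" by auto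
  then show ?case using Cons by (simp add: proots_mult del: mult_pCons_left)
qed simp

lemma mat_trace_pow_eq_sum_eigenvalues:
  fixes A :: "complex mat"
  assumes A: "A \<in> carrier_mat n n"
  shows "mat_trace (A ^\<^sub>m m) = (\<Sum>e\<in>#proots (char_poly A). e ^ m)"
proof -
  obtain es where "char_poly A = (\<Prod>a\<leftarrow>es. [:- a, 1:])"
    using char_poly_factorized[OF A] by blast
  from schur_decomposition_exists[OF A this] obtain B
    where B: "B \<in> carrier_mat n n" "upper_triangular B" and sim: "similar_mat A B" by blast
  then obtain P Q where "similar_mat_wit A B P Q" by (auto simp: similar_mat_def)
  then have "mat_trace (A ^\<^sub>m m) = mat_trace (B ^\<^sub>m m)"
    by (intro mat_trace_similar similar_mat_wit_pow)
  also have "\<dots> = (\<Sum>i<n. B $$ (i, i) ^ m)"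
    using upper_triangular_pow[OF B] B(1) by (simp add: mat_trace_def)
  also have "\<dots> = (\<Sum>e\<leftarrow>diag_mat B. e ^ m)"
    using B(1) by (simp add: diag_mat_def sum_list_sum_nth atLeast0LessThan)
  also have "\<dots> = (\<Sum>e\<in>#mset (diag_mat B). e ^ m)"
    by (simp flip: sum_mset_sum_list)
  also have "mset (diag_mat B) = proots (char_poly A)"
    by (simp add: char_poly_similar[OF sim] char_poly_upper_triangular[OF B]
        proots_prod_list_linear)
  finally show ?thesis .
qed

section \<open>Graph eigenvalues and closed walks\<close>

definition adjacency_mat :: "(nat \<Rightarrow> 'a) \<Rightarrow> nat \<Rightarrow> ('a \<Rightarrow> 'a \<Rightarrow> bool) \<Rightarrow> 'b :: semiring_1 mat" where
  "adjacency_mat b N E = mat N N (\<lambda>(i, j). if E (b i) (b j) then 1 else 0)"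

lemma dim_adjacency_mat [simp]:
  "dim_row (adjacency_mat b N E) = N" "dim_col (adjacency_mat b N E) = N"
  by (simp_all add: adjacency_mat_def)

lemma adjacency_mat_carrier [simp]: "adjacency_mat b N E \<in> carrier_mat N N"
  by (simp add: carrier_matI)

primrec walk_count :: "'a set \<Rightarrow> ('a \<Rightarrow> 'a \<Rightarrow> bool) \<Rightarrow> nat \<Rightarrow> 'a \<Rightarrow> 'a \<Rightarrow> nat" where
  "walk_count V E 0 u v = (if u = v then 1 else 0)"
| "walk_count V E (Suc m) u v = (\<Sum>w | w \<in> V \<and> E w v. walk_count V E m u w)"

lemma bij_betw_map_permutation:
  assumes b: "bij_betw b A V"
  shows "bij_betw (map_permutation A b) {p. p permutes A} {p. p permutes V}"
proof (rule bij_betw_byWitness[where f' = "map_permutation V (inv_into A b)"])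
  have inv: "bij_betw (inv_into A b) V A" by (rule bij_betw_inv_into[OF b])
  show "\<forall>p\<in>{p. p permutes A}. map_permutation V (inv_into A b) (map_permutation A b p) = p"
    using b by (auto intro!: map_permutation_compose_inv simp: bij_betw_def)
  show "\<forall>p\<in>{p. p permutes V}. map_permutation A b (map_permutation V (inv_into A b) p) = p"
    using inv b by (auto intro!: map_permutation_compose_inv simp: bij_betw_def f_inv_into_f)
  show "map_permutation A b ` {p. p permutes A} \<subseteq> {p. p permutes V}"
    using map_permutation_permutes[OF b] by auto
  show "map_permutation V (inv_into A b) ` {p. p permutes V} \<subseteq> {p. p permutes A}"
    using map_permutation_permutes[OF inv] by auto
qed

lemma graph_charpoly_eq_char_poly:
  assumes b: "bij_betw b {0..<N} V"
  shows "graph_charpoly V E = char_poly (adjacency_mat b N E)"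
proof -
  let ?f = "\<lambda>v w. (if w = v then [:0, 1:] else 0) - (if E v w then 1 else 0) :: complex poly"
  let ?M = "char_poly_matrix (adjacency_mat b N E)"
  let ?m = "map_permutation {0..<N} b"
  have inj: "inj_on b {0..<N}" using b by (rule bij_betw_imp_inj_on)
  have "graph_charpoly V E = (\<Sum>p | p permutes V. of_int (sign p) * (\<Prod>v\<in>V. ?f v (p v)))"
    unfolding graph_charpoly_def ..
  also have "\<dots> = (\<Sum>p | p permutes {0..<N}. of_int (sign (?m p)) * (\<Prod>v\<in>V. ?f v (?m p v)))"
    by (rule sum.reindex_bij_betw[OF bij_betw_map_permutation[OF b], symmetric])
  also have "\<dots> = (\<Sum>p | p permutes {0..<N}. of_int (sign p) * (\<Prod>i = 0..<N. ?M $$ (i, p i)))"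
  proof (rule sum.cong[OF refl])
    fix p assume "p \<in> {p. p permutes {0..<N}}"
    then have p: "p permutes {0..<N}" by simp
    have "(\<Prod>v\<in>V. ?f v (?m p v)) = (\<Prod>i = 0..<N. ?f (b i) (?m p (b i)))"
      by (rule prod.reindex_bij_betw[OF b, symmetric])
    also have "\<dots> = (\<Prod>i = 0..<N. ?M $$ (i, p i))"
    proof (rule prod.cong[OF refl])
      fix i assume i: "i \<in> {0..<N}"
      then have pi: "p i \<in> {0..<N}" using permutes_in_image[OF p] by simp
      have "?m p (b i) = b (p i)" using inj i by (rule map_permutation_apply)
      moreover have "b (p i) = b i \<longleftrightarrow> p i = i" using inj i pi by (auto dest: inj_onD)
      ultimately show "?f (b i) (?m p (b i)) = ?M $$ (i, p i)"
        using i pi by (auto simp: char_poly_matrix_def adjacency_mat_def one_pCons)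
    qed
    finally show "of_int (sign (?m p)) * (\<Prod>v\<in>V. ?f v (?m p v)) =
        of_int (sign p) * (\<Prod>i = 0..<N. ?M $$ (i, p i))"
      using sign_map_permutation[OF inj p] by simp
  qed
  also have "\<dots> = char_poly (adjacency_mat b N E)"
    unfolding char_poly_def by (subst det_def'[of _ N]) auto
  finally show ?thesis .
qed

lemma adjacency_mat_pow:
  assumes b: "bij_betw b {0..<N} V" and i: "i < N" and "j < N"
  shows "(adjacency_mat b N E ^\<^sub>m m :: 'b :: semiring_1 mat) $$ (i, j) =
    of_nat (walk_count V E m (b i) (b j))"
  using \<open>j < N\<close>
proof (induction m arbitrary: j)
  case 0
  have "b i = b j \<longleftrightarrow> i = j"
    using bij_betw_imp_inj_on[OF b] i 0 by (auto dest: inj_onD)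
  then show ?case using 0 i by (simp add: adjacency_mat_def)
next
  case (Suc m)
  let ?A = "adjacency_mat b N E :: 'b mat"
  have finV: "finite V" using bij_betw_finite[OF b] by simp
  have "(?A ^\<^sub>m Suc m) $$ (i, j) = (\<Sum>l = 0..<N. (?A ^\<^sub>m m) $$ (i, l) * ?A $$ (l, j))"
    using i Suc.prems by (simp add: scalar_prod_def)
  also have "\<dots> = (\<Sum>l = 0..<N. if E (b l) (b j) then of_nat (walk_count V E m (b i) (b l)) else 0)"
    using Suc by (intro sum.cong refl) (simp add: adjacency_mat_def)
  also have "\<dots> = (\<Sum>w\<in>V. if E w (b j) then of_nat (walk_count V E m (b i) w) else 0)"
    by (rule sum.reindex_bij_betw[OF b])
  also have "\<dots> = of_nat (walk_count V E (Suc m) (b i) (b j))"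
    by (auto simp: sum.inter_filter[OF finV] intro!: sum.cong)
  finally show ?case .
qed

lemma size_graph_eigenvalues:
  assumes "finite V"
  shows "size (graph_eigenvalues V E) = card V"
proof -
  obtain b where b: "bij_betw b {0..<card V} V" using ex_bij_betw_nat_finite[OF assms] by blast
  show ?thesis
    by (simp add: graph_eigenvalues_def graph_charpoly_eq_char_poly[OF b] size_proots_complex
        degree_monic_char_poly[of _ "card V"])
qed

lemma power_sum_graph_eigenvalues:
  assumes "finite V"
  shows "(\<Sum>e\<in>#graph_eigenvalues V E. e ^ m) = of_nat (\<Sum>v\<in>V. walk_count V E m v v)"
proof -
  obtain b where b: "bij_betw b {0..<card V} V" using ex_bij_betw_nat_finite[OF assms] by blast
  let ?A = "adjacency_mat b (card V) E :: complex mat"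
  have "(\<Sum>e\<in>#graph_eigenvalues V E. e ^ m) = mat_trace (?A ^\<^sub>m m)"
    by (simp add: graph_eigenvalues_def graph_charpoly_eq_char_poly[OF b]
        mat_trace_pow_eq_sum_eigenvalues[OF adjacency_mat_carrier])
  also have "\<dots> = (\<Sum>i = 0..<card V. of_nat (walk_count V E m (b i) (b i)))"
    using pow_carrier_mat[OF adjacency_mat_carrier, of b "card V" E m, where ?'a = complex]
    by (simp add: mat_trace_def adjacency_mat_pow[OF b] atLeast0LessThan)
  also have "\<dots> = of_nat (\<Sum>v\<in>V. walk_count V E m v v)"
    unfolding of_nat_sum by (rule sum.reindex_bij_betw[OF b])
  finally show ?thesis .
qed

section \<open>Multisets with equal power sums\<close>

lemma sum_mset_eq_of_nat_count:
  fixes f :: "'a \<Rightarrow> 'b :: semiring_1"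
  assumes "\<And>e. e \<in># A \<Longrightarrow> e \<noteq> z \<Longrightarrow> f e = 0"
  shows "(\<Sum>e\<in>#A. f e) = of_nat (count A z) * f z"
  using assms by (induction A) (auto simp: algebra_simps)

lemma sum_mset_poly_eq_of_power_sums:
  fixes A B :: "'a :: comm_ring_1 multiset"
  assumes power_sums: "\<And>m. (\<Sum>e\<in>#A. e ^ Suc m) = (\<Sum>e\<in>#B. e ^ Suc m)" and "poly p 0 = 0"
  shows "(\<Sum>e\<in>#A. poly p e) = (\<Sum>e\<in>#B. poly p e)"
proof -
  obtain q where p: "p = pCons 0 q" using \<open>poly p 0 = 0\<close> by (cases p) auto
  have "poly p e = (\<Sum>i\<le>degree q. coeff q i * e ^ Suc i)" for e
    unfolding p by (simp add: poly_altdef[of q] sum_distrib_left mult.left_commute)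
  moreover have "(\<Sum>e\<in>#C. \<Sum>i\<le>degree q. coeff q i * e ^ Suc i) =
      (\<Sum>i\<le>degree q. coeff q i * (\<Sum>e\<in>#C. e ^ Suc i))" for C
    by (induction C) (simp_all add: sum.distrib distrib_left)
  ultimately show ?thesis by (simp only: power_sums)
qed

lemma filter_nonzero_eq_of_power_sums:
  fixes A B :: "'a :: field_char_0 multiset"
  assumes power_sums: "\<And>m. (\<Sum>e\<in>#A. e ^ Suc m) = (\<Sum>e\<in>#B. e ^ Suc m)"
  shows "{#e \<in># A. e \<noteq> 0#} = {#e \<in># B. e \<noteq> 0#}"
proof (rule multiset_eqI)
  fix z
  define W where "W = insert 0 (set_mset A \<union> set_mset B) - {z}"
  define p where "p = (\<Prod>w\<in>W. [:- w, 1:])"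
  have root: "poly p w = 0" if "w \<in> W" for w
    using that by (auto simp: p_def poly_prod W_def)
  have "poly p z \<noteq> 0" by (auto simp: p_def poly_prod W_def)
  have "count A z = count B z" if "z \<noteq> 0"
  proof -
    have count: "(\<Sum>e\<in>#C. poly p e) = of_nat (count C z) * poly p z" if "C \<in> {A, B}" for C
      using that root by (intro sum_mset_eq_of_nat_count) (auto simp: W_def)
    have "(\<Sum>e\<in>#A. poly p e) = (\<Sum>e\<in>#B. poly p e)"
      using \<open>z \<noteq> 0\<close> root by (intro sum_mset_poly_eq_of_power_sums power_sums) (auto simp: W_def)
    then show ?thesis using \<open>poly p z \<noteq> 0\<close> by (simp add: count)
  qed
  then show "count {#e \<in># A. e \<noteq> 0#} z = count {#e \<in># B. e \<noteq> 0#} z" by simp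
qed

section \<open>The spectrum of the Cayley graph of the full cycles\<close>

lemma cayley_adj_iff:
  assumes "u permutes X"
  shows "cayley_adj S u v \<longleftrightarrow> v \<circ> inv u \<in> S"
proof
  assume "cayley_adj S u v"
  then show "v \<circ> inv u \<in> S"
    using permutes_inv_o(1)[OF assms] by (auto simp: cayley_adj_def comp_assoc)
next
  assume "v \<circ> inv u \<in> S"
  moreover have "v = (v \<circ> inv u) \<circ> u" using permutes_inv_o(2)[OF assms] by (simp add: comp_assoc)
  ultimately show "cayley_adj S u v" unfolding cayley_adj_def by blast
qed

lemma sum_cayley_predecessors:
  fixes f :: "('a \<Rightarrow> 'a) \<Rightarrow> 'b :: comm_monoid_add"
  assumes S: "\<And>a. a \<in> S \<Longrightarrow> a permutes X" "\<And>a. a \<in> S \<Longrightarrow> inv a \<in> S" and v: "v permutes X"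
  shows "(\<Sum>w | w permutes X \<and> cayley_adj S w v. f w) = (\<Sum>a\<in>S. f (a \<circ> v))"
proof (rule sum.reindex_bij_witness[where i = "\<lambda>a. a \<circ> v" and j = "\<lambda>w. w \<circ> inv v"])
  fix w assume "w \<in> {w. w permutes X \<and> cayley_adj S w v}"
  then have w: "w permutes X" "v \<circ> inv w \<in> S" by (auto simp: cayley_adj_iff)
  show inverse: "w \<circ> inv v \<circ> v = w" by (simp add: comp_assoc permutes_inv_o(2)[OF v])
  have "inv (v \<circ> inv w) = w \<circ> inv v"
    using o_inv_distrib[OF permutes_bij[OF v] permutes_bij[OF permutes_inv[OF w(1)]]]
    by (simp add: permutes_inv_inv[OF w(1)])
  then show "w \<circ> inv v \<in> S" using S(2)[OF w(2)] by simp
  show "f (w \<circ> inv v \<circ> v) = f w" by (simp only: inverse)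
next
  fix a assume a: "a \<in> S"
  show "a \<circ> v \<circ> inv v = a" by (simp add: comp_assoc permutes_inv_o(1)[OF v])
  have "v = inv a \<circ> (a \<circ> v)" by (simp add: o_assoc permutes_inv_o(2)[OF S(1)[OF a]])
  then have "cayley_adj S (a \<circ> v) v" using S(2)[OF a] unfolding cayley_adj_def by blast
  then show "a \<circ> v \<in> {w. w permutes X \<and> cayley_adj S w v}"
    using permutes_compose[OF v S(1)[OF a]] by simp
qed

lemma card_times_walk_count_cycles:
  fixes X :: "'a set"
  assumes fin: "finite X" and u: "u permutes X" and v: "v permutes X"
  defines "V \<equiv> {p. p permutes X}" and "E \<equiv> cayley_adj (cyclic_perms X)"
  shows "int (card X * walk_count V E (Suc m) u v) =
    (\<Sum>k<card X. (-1) ^ k * hook_eigenvalue (card X) k ^ m * hook_char X k (v \<circ> inv u))"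
  using v
proof (induction m arbitrary: v)
  case 0
  have finV: "finite {w \<in> V. E w v}" using finite_permutations[OF fin] by (simp add: V_def)
  have "walk_count V E (Suc 0) u v = (if v \<circ> inv u \<in> cyclic_perms X then 1 else 0)"
    using u finV by (simp add: V_def E_def cayley_adj_iff[OF u, symmetric])
  then show ?case
    using alternating_sum_hook_char[OF fin permutes_compose[OF permutes_inv[OF u] 0]]
    by (simp del: o_apply)
next
  case (Suc m)
  let ?n = "card X"
  let ?c = "\<lambda>k. (-1) ^ k * hook_eigenvalue ?n k ^ m"
  have closed: "a permutes X" "inv a \<in> cyclic_perms X" if "a \<in> cyclic_perms X" for a
    using that fin by (simp_all add: cyclic_perms_permutes inv_cyclic_perms)
  have "int (?n * walk_count V E (Suc (Suc m)) u v) =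
      (\<Sum>w | w permutes X \<and> E w v. int (?n * walk_count V E (Suc m) u w))"
    by (subst walk_count.simps(2))
      (simp only: V_def mem_Collect_eq of_nat_mult of_nat_sum sum_distrib_left)
  also have "\<dots> = (\<Sum>a\<in>cyclic_perms X. int (?n * walk_count V E (Suc m) u (a \<circ> v)))"
    unfolding E_def by (rule sum_cayley_predecessors[OF closed Suc.prems])
  also have "\<dots> = (\<Sum>a\<in>cyclic_perms X. \<Sum>k<?n. ?c k * hook_char X k (a \<circ> (v \<circ> inv u)))"
    using Suc.IH[OF permutes_compose[OF Suc.prems closed(1)]]
    by (intro sum.cong refl) (simp only: comp_assoc)
  also have "\<dots> = (\<Sum>k<?n. ?c k * (\<Sum>a\<in>cyclic_perms X. hook_char X k (a \<circ> (v \<circ> inv u))))"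
    by (subst sum.swap) (simp only: sum_distrib_left)
  also have "\<dots> = (\<Sum>k<?n. ?c k * (hook_eigenvalue ?n k * hook_char X k (v \<circ> inv u)))"
    using sum_cyclic_perms_hook_char[OF fin permutes_compose[OF permutes_inv[OF u] Suc.prems]]
    by (intro sum.cong refl) simp
  also have "\<dots> = (\<Sum>k<?n. (-1) ^ k * hook_eigenvalue ?n k ^ Suc m * hook_char X k (v \<circ> inv u))"
    by (simp add: mult_ac)
  finally show ?case .
qed

lemma hook_eigenvalue_times_binomial:
  assumes "k < n"
  shows "hook_eigenvalue n k * int ((n - 1) choose k) = (-1) ^ k * fact (n - 1)"
proof -
  have "fact k * fact (n - 1 - k) * ((n - 1) choose k) = (fact (n - 1) :: nat)"
    using assms by (intro binomial_fact_lemma) auto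
  then have "int (fact k * fact (n - 1 - k) * ((n - 1) choose k)) = fact (n - 1)"
    by (metis of_nat_fact)
  then show ?thesis by (simp add: hook_eigenvalue_def mult.assoc)
qed

lemma sum_closed_walks_cycles:
  fixes X :: "'a set"
  assumes fin: "finite X" and X: "X \<noteq> {}"
  defines "V \<equiv> {p. p permutes X}" and "E \<equiv> cayley_adj (cyclic_perms X)"
  shows "int (\<Sum>v\<in>V. walk_count V E (Suc m) v v) =
    (\<Sum>k<card X. (int ((card X - 1) choose k))\<^sup>2 * hook_eigenvalue (card X) k ^ Suc m)"
proof -
  let ?n = "card X"
  let ?l = "hook_eigenvalue ?n" and ?b = "\<lambda>k. int ((?n - 1) choose k)"
  have n: "?n > 0" using fin X by (simp add: card_gt_0_iff)
  have card_V: "card V = ?n * fact (?n - 1)"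
    using fin n by (simp add: V_def card_permutations fact_reduce)
  have "int ?n * int (\<Sum>v\<in>V. walk_count V E (Suc m) v v) =
      (\<Sum>v\<in>V. int (?n * walk_count V E (Suc m) v v))"
    by (simp only: of_nat_sum of_nat_mult sum_distrib_left)
  also have "\<dots> = (\<Sum>v\<in>V. \<Sum>k<?n. (-1) ^ k * ?l k ^ m * ?b k)"
  proof (rule sum.cong[OF refl])
    fix v assume "v \<in> V"
    then have v: "v permutes X" by (simp add: V_def)
    show "int (?n * walk_count V E (Suc m) v v) = (\<Sum>k<?n. (-1) ^ k * ?l k ^ m * ?b k)"
      unfolding V_def E_def card_times_walk_count_cycles[OF fin v v] permutes_inv_o(1)[OF v]
      by (intro sum.cong refl) (simp add: hook_char_id[OF fin])
  qed
  also have "\<dots> = int ?n * (\<Sum>k<?n. ((-1) ^ k * fact (?n - 1)) * ?l k ^ m * ?b k)"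
    by (simp add: card_V sum_distrib_left mult_ac)
  also have "\<dots> = int ?n * (\<Sum>k<?n. (?l k * ?b k) * ?l k ^ m * ?b k)"
    by (intro arg_cong[where f = "times (int ?n)"] sum.cong refl)
      (simp only: hook_eigenvalue_times_binomial lessThan_iff)
  also have "\<dots> = int ?n * (\<Sum>k<?n. (?b k)\<^sup>2 * ?l k ^ Suc m)"
    by (simp add: power2_eq_square mult_ac)
  finally show ?thesis using n by simp
qed

definition hook_spectrum :: "nat \<Rightarrow> complex multiset" where
  "hook_spectrum n =
    (\<Sum>k<n. replicate_mset (((n - 1) choose k)\<^sup>2) (of_int (hook_eigenvalue n k)))"

lemma sum_mset_hook_spectrum:
  fixes f :: "complex \<Rightarrow> 'b :: semiring_1"
  shows "(\<Sum>e\<in>#hook_spectrum n. f e) =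
    (\<Sum>k<n. of_nat (((n - 1) choose k)\<^sup>2) * f (of_int (hook_eigenvalue n k)))"
proof -
  have "(\<Sum>e\<in>#(\<Sum>k\<in>K. M k). f e) = (\<Sum>k\<in>K. \<Sum>e\<in>#M k. f e)" if "finite K"
    for K and M :: "nat \<Rightarrow> complex multiset"
    using that by induction simp_all
  then show ?thesis by (simp add: hook_spectrum_def)
qed

lemma hook_eigenvalue_nonzero [simp]: "hook_eigenvalue n k \<noteq> 0"
  by (simp add: hook_eigenvalue_def)

lemma hook_spectrum_Ints_nonzero: "e \<in># hook_spectrum n \<Longrightarrow> e \<in> \<int> \<and> e \<noteq> 0"
  by (auto simp: hook_spectrum_def set_mset_sum split: if_splits)

lemma size_hook_spectrum:
  assumes "0 < n"
  shows "size (hook_spectrum n) = (2 * n - 2) choose (n - 1)"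
proof -
  have "{..<n} = {..n - 1}" using assms by auto
  then show ?thesis
    using choose_square_sum[of "n - 1"]
    by (simp add: hook_spectrum_def size_multiset_sum right_diff_distrib')
qed

lemma energy_hook_spectrum:
  assumes "0 < n"
  shows "(\<Sum>e\<in>#hook_spectrum n. cmod e) = 2 ^ (n - 1) * fact (n - 1)"
proof -
  let ?b = "\<lambda>k. (n - 1) choose k"
  have upto: "{..<n} = {..n - 1}" using assms by auto
  have norm: "real (?b k) * cmod (of_int (hook_eigenvalue n k)) = fact (n - 1)" if "k < n" for k
  proof -
    have "real (?b k) * cmod (of_int (hook_eigenvalue n k)) =
        \<bar>real_of_int (hook_eigenvalue n k * int (?b k))\<bar>"
      by (simp add: abs_mult mult.commute)
    also have "\<dots> = fact (n - 1)"
      unfolding hook_eigenvalue_times_binomial[OF that] by (simp add: abs_mult power_abs)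
    finally show ?thesis .
  qed
  have "(\<Sum>e\<in>#hook_spectrum n. cmod e) =
      (\<Sum>k<n. real (?b k) * (real (?b k) * cmod (of_int (hook_eigenvalue n k))))"
    by (simp add: sum_mset_hook_spectrum power2_eq_square mult.assoc)
  also have "\<dots> = (\<Sum>k<n. real (?b k) * fact (n - 1))"
    by (intro sum.cong refl) (simp only: norm lessThan_iff)
  also have "\<dots> = real (\<Sum>k\<le>n - 1. ?b k) * fact (n - 1)"
    by (simp add: upto sum_distrib_right)
  finally show ?thesis by (simp add: choose_row_sum)
qed

lemma nonzero_eigenvalues_cayley_cycles:
  assumes "finite X" "X \<noteq> {}"
  shows "{#e \<in># graph_eigenvalues {p. p permutes X} (cayley_adj (cyclic_perms X)). e \<noteq> 0#} =
    hook_spectrum (card X)"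
proof -
  let ?E = "graph_eigenvalues {p. p permutes X} (cayley_adj (cyclic_perms X))"
  have "(\<Sum>e\<in>#?E. e ^ Suc m) = (\<Sum>e\<in>#hook_spectrum (card X). e ^ Suc m)" for m
  proof -
    have "(\<Sum>e\<in>#?E. e ^ Suc m) = of_int (int (\<Sum>v | v permutes X.
        walk_count {p. p permutes X} (cayley_adj (cyclic_perms X)) (Suc m) v v))"
      using power_sum_graph_eigenvalues[OF finite_permutations[OF assms(1)]]
      by (simp only: of_int_of_nat_eq)
    also have "\<dots> = (\<Sum>e\<in>#hook_spectrum (card X). e ^ Suc m)"
      unfolding sum_closed_walks_cycles[OF assms] sum_mset_hook_spectrum by simp
    finally show ?thesis .
  qed
  then have "{#e \<in># ?E. e \<noteq> 0#} = {#e \<in># hook_spectrum (card X). e \<noteq> 0#}"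
    by (rule filter_nonzero_eq_of_power_sums)
  also have "\<dots> = hook_spectrum (card X)"
    using hook_spectrum_Ints_nonzero by (simp add: filter_mset_eq_conv)
  finally show ?thesis .
qed

lemma graph_eigenvalues_full_cycles:
  assumes "0 < n"
  obtains z where "graph_eigenvalues (Sym n) (cayley_adj (full_cycles n)) =
      hook_spectrum n + replicate_mset z 0"
    and "z + ((2 * n - 2) choose (n - 1)) = fact n"
proof -
  let ?E = "graph_eigenvalues (Sym n) (cayley_adj (full_cycles n))"
  have "{#e \<in># ?E. e \<noteq> 0#} = hook_spectrum n"
    using nonzero_eigenvalues_cayley_cycles[of "{1..n}"] assms
    by (simp add: Sym_def full_cycles_eq_cyclic_perms)
  moreover have "{#e \<in># ?E. \<not> e \<noteq> 0#} = replicate_mset (count ?E 0) 0"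
    by (simp add: filter_eq_replicate_mset)
  ultimately have spectrum: "?E = hook_spectrum n + replicate_mset (count ?E 0) 0"
    using multiset_partition[of ?E "\<lambda>e. e \<noteq> 0"] by simp
  have "size ?E = fact n"
    by (simp add: size_graph_eigenvalues Sym_def finite_permutations card_permutations)
  then have "count ?E 0 + ((2 * n - 2) choose (n - 1)) = fact n"
    using arg_cong[OF spectrum, of size] size_hook_spectrum[OF assms] by simp
  with spectrum show thesis by (rule that)
qed

lemma double_le_two_power:
  assumes "4 \<le> n"
  shows "2 * n \<le> 2 ^ (n - 1)"
  using assms
proof (induction n rule: dec_induct)
  case (step n)
  then have "2 ^ (Suc n - 1) = 2 * (2 ^ (n - 1) :: nat)" by (cases n) auto
  then show ?case using step by simp
qed simp

theorem theorem1p1: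
  fixes n :: nat
  assumes "n \<ge> 4"
  shows "graph_integral (Sym n) (cayley_adj (full_cycles n))
       \<and> hyperenergetic (Sym n) (cayley_adj (full_cycles n))
       \<and> graph_energy (Sym n) (cayley_adj (full_cycles n)) = 2 ^ (n - 1) * fact (n - 1)
       \<and> int (graph_nullity (Sym n) (cayley_adj (full_cycles n)))
           = int (fact n) - int ((2 * n - 2) choose (n - 1))"
proof -
  have n: "0 < n" using assms by simp
  obtain z where spectrum: "graph_eigenvalues (Sym n) (cayley_adj (full_cycles n)) =
      hook_spectrum n + replicate_mset z 0"
    and nullity: "z + ((2 * n - 2) choose (n - 1)) = fact n"
    using graph_eigenvalues_full_cycles[OF n] .
  have integral: "graph_integral (Sym n) (cayley_adj (full_cycles n))"
    using hook_spectrum_Ints_nonzero by (auto simp: graph_integral_def spectrum split: if_splits)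
  have energy: "graph_energy (Sym n) (cayley_adj (full_cycles n)) = 2 ^ (n - 1) * fact (n - 1)"
    using energy_hook_spectrum[OF n] by (simp add: graph_energy_def spectrum)
  have "count (hook_spectrum n) 0 = 0"
    using hook_spectrum_Ints_nonzero by (metis count_inI)
  then have "graph_nullity (Sym n) (cayley_adj (full_cycles n)) = z"
    by (simp add: graph_nullity_def spectrum)
  moreover have "2 * fact n \<le> (2 ^ (n - 1) * fact (n - 1) :: real)"
    using of_nat_mono[OF double_le_two_power[OF assms], where ?'a = real] n
    by (simp add: fact_reduce)
  then have "hyperenergetic (Sym n) (cayley_adj (full_cycles n))"
    unfolding hyperenergetic_def energy by (simp add: Sym_def card_permutations)
  ultimately show ?thesis using integral energy nullity by linarith
qed

end
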